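(* Let $n\ge 1$ and let $f:\mathbb{R}^n\to\mathbb{R}$ be a function with Fourier transform $\widehat f$ such that $f>0$ and $\widehat f>0$ everywhere, and such that each $h\in\{f,\widehat f\}$ satisfies: (i) $h$ is continuous; (ii) $h(x)=O((1+\|x\|_2)^{-n-\delta})$ for some $\delta>0$; (iii) $\sum_{\lambda\in\Lambda^*}|\widehat h(t\lambda)|<\infty$ for every lattice $\Lambda\subset\mathbb{R}^n$ and every $t>0$; (iv) $\widehat h$ is real-valued, nonnegative, and monotonically non-increasing on rays, i.e. $0\le\widehat h(tv)\le\widehat h(v)$ for all $v\in\mathbb{R}^n$ and $t\ge 1$. Suppose that $K,K'\subset\mathbb{R}^n$ are compact sets with the origin in their interiors, starlike with respect to the origin, such that $$2\nu_f(K)+\nu_{\widehat f}(K')<1.$$ Then for any lattice $\Lambda\subset\mathbb{R}^n$, $$\sigma_K(\Lambda)\,\rho_{K'}(\Lambda^* )\ \le\ 1.$$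
   Context: A lattice $\Lambda\subset\mathbb{R}^n$ is the set of integral linear combinations of some basis of $\mathbb{R}^n$; its dual is $\Lambda^*=\{x\in\mathbb{R}^n: x\cdot\lambda\in\mathbb{Z}\ \text{for all }\lambda\in\Lambda\}$. The Fourier transform is $\widehat f(x)=\int_{\mathbb{R}^n} f(r)e^{-2\pi i r\cdot x}\,dr$. For a positive function $h$ on $\mathbb{R}^n$ and $K\subset\mathbb{R}^n$, $$\nu_h(K):=\inf_{0<u\le 1}\ \sup_{x\notin K}\ \frac{h(x)}{u^n h(ux)}.$$ For a compact set $K$ with the origin in its interior and starlike with respect to the origin, put $\|x\|_K:=\min\{r\ge 0: x\in rK\}$; starlike means that for each $r>0$, $x\notin rK\iff\|x\|_K>r$ (equivalently $tK\subset K$ for all $t\in[0,1]$). Define $$\sigma_K(\Lambda):=\min_{\lambda\in\Lambda,\ \lambda\neq 0}\|\lambda\|_K,\qquad \rho_K(\Lambda):=\max_{v\in\mathbb{R}^n}\ \min_{\lambda\in\Lambda}\|\lambda-v\|_K,$$ where the outer maximum is read as a supremum. *)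

theory Defs
  imports "HOL-Analysis.Analysis"
begin

definition is_lattice :: "(real ^ 'n) set \<Rightarrow> bool" where
  "is_lattice L \<longleftrightarrow> (\<exists>B. independent B \<and> span B = UNIV \<and>
     L = {\<Sum>b\<in>B. of_int (c b) *\<^sub>R b | c :: real ^ 'n \<Rightarrow> int. True})"

definition dual_lattice :: "(real ^ 'n) set \<Rightarrow> (real ^ 'n) set" where
  "dual_lattice L = {x. \<forall>l\<in>L. x \<bullet> l \<in> \<int>}"

definition fourier :: "(real ^ 'n \<Rightarrow> real) \<Rightarrow> real ^ 'n \<Rightarrow> complex" where
  "fourier h x =
     (LINT r|lborel. complex_of_real (h r) * exp (- 2 * pi * \<i> * complex_of_real (r \<bullet> x)))"

text \<open>The supremum may be infinite, so \<open>nu\<close> takes extended real values.\<close>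

definition nu :: "(real ^ 'n \<Rightarrow> real) \<Rightarrow> (real ^ 'n) set \<Rightarrow> ereal" where
  "nu h K = (INF u\<in>{0<..1::real}. SUP x\<in>-K. ereal (h x / (u ^ CARD('n) * h (u *\<^sub>R x))))"

definition star_norm :: "(real ^ 'n) set \<Rightarrow> real ^ 'n \<Rightarrow> real" where
  "star_norm K x = Inf {r. 0 \<le> r \<and> x \<in> (*\<^sub>R) r ` K}"

text \<open>The infimum is a minimum when \<open>K\<close> is compact with the origin in its interior.\<close>

lemma star_norm_set_nonempty:
  fixes K :: "(real ^ 'n) set"
  assumes "0 \<in> interior K"
  shows "{r. 0 \<le> r \<and> x \<in> (*\<^sub>R) r ` K} \<noteq> {}"
proof -
  obtain e where e: "e > 0" "ball 0 e \<subseteq> K"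
    using assms unfolding mem_interior by blast
  define r where "r = (norm x + 1) / e"
  have r: "r > 0" using e by (simp add: r_def add_nonneg_pos)
  have "norm x < norm x + 1" by simp
  then have "norm x < r * e" using e by (simp add: r_def)
  then have "(1 / r) *\<^sub>R x \<in> ball 0 e"
    using r by (simp add: field_simps)
  then have "(1 / r) *\<^sub>R x \<in> K" using e by blast
  moreover have "x = r *\<^sub>R ((1 / r) *\<^sub>R x)" using r by simp
  ultimately have "x \<in> (*\<^sub>R) r ` K" by blast
  then show ?thesis using r by (auto intro: less_imp_le)
qed

lemma star_norm_min:
  fixes K :: "(real ^ 'n) set"
  assumes "compact K" "0 \<in> interior K"
  shows "0 \<le> star_norm K x \<and> x \<in> (*\<^sub>R) (star_norm K x) ` K"
    and "\<And>r. 0 \<le> r \<Longrightarrow> x \<in> (*\<^sub>R) r ` K \<Longrightarrow> star_norm K x \<le> r"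
proof -
  let ?S = "{r. 0 \<le> r \<and> x \<in> (*\<^sub>R) r ` K}"
  have bdd: "bdd_below ?S" by (rule bdd_belowI[of _ 0]) auto
  have "closed ?S"
    unfolding closed_sequential_limits
  proof (intro allI impI)
    fix s l assume *: "(\<forall>n. s n \<in> ?S) \<and> s \<longlonglongrightarrow> l"
    then have "\<forall>n. \<exists>k\<in>K. x = s n *\<^sub>R k" by auto
    then obtain k where k: "\<And>n. k n \<in> K" "\<And>n. x = s n *\<^sub>R k n" by metis
    obtain k0 q where q: "k0 \<in> K" "strict_mono q" "(k \<circ> q) \<longlonglongrightarrow> k0"
      using assms(1) k(1) unfolding compact_def by blast
    have "(s \<circ> q) \<longlonglongrightarrow> l" using * q(2) by (simp add: LIMSEQ_subseq_LIMSEQ)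
    then have "(\<lambda>n. (s \<circ> q) n *\<^sub>R (k \<circ> q) n) \<longlonglongrightarrow> l *\<^sub>R k0"
      using q(3) by (rule tendsto_scaleR)
    moreover have "(\<lambda>n. (s \<circ> q) n *\<^sub>R (k \<circ> q) n) = (\<lambda>n. x)" using k(2) by auto
    ultimately have "x = l *\<^sub>R k0" by (simp add: LIMSEQ_const_iff)
    moreover have "0 \<le> l" using * by (intro LIMSEQ_le_const[of s]) auto
    ultimately show "l \<in> ?S" using q(1) by blast
  qed
  then have "star_norm K x \<in> ?S"
    unfolding star_norm_def
    by (intro closed_contains_Inf star_norm_set_nonempty assms bdd)
  then show "0 \<le> star_norm K x \<and> x \<in> (*\<^sub>R) (star_norm K x) ` K" by simp
  show "star_norm K x \<le> r" if "0 \<le> r" "x \<in> (*\<^sub>R) r ` K" for r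
    unfolding star_norm_def using that bdd by (intro cInf_lower) auto
qed

definition starlike_origin :: "(real ^ 'n) set \<Rightarrow> bool" where
  "starlike_origin K \<longleftrightarrow> (\<forall>r>0. \<forall>x. x \<notin> (*\<^sub>R) r ` K \<longleftrightarrow> star_norm K x > r)"

lemma starlike_origin_iff:
  fixes K :: "(real ^ 'n) set"
  assumes K: "compact K" "0 \<in> interior K"
  shows "starlike_origin K \<longleftrightarrow> (\<forall>t\<in>{0..1}. (*\<^sub>R) t ` K \<subseteq> K)"
proof
  assume s: "starlike_origin K"
  show "\<forall>t\<in>{0..1}. (*\<^sub>R) t ` K \<subseteq> K"
  proof (intro ballI subsetI)
    fix t y assume t: "t \<in> {0..1::real}" and "y \<in> (*\<^sub>R) t ` K"
    then have "star_norm K y \<le> t" by (intro star_norm_min(2)[OF K]) auto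
    then have "\<not> star_norm K y > 1" using t by auto
    then have "y \<in> (*\<^sub>R) 1 ` K" using s unfolding starlike_origin_def by (metis zero_less_one)
    then show "y \<in> K" by simp
  qed
next
  assume s: "\<forall>t\<in>{0..1}. (*\<^sub>R) t ` K \<subseteq> K"
  show "starlike_origin K"
    unfolding starlike_origin_def
  proof (intro allI impI iffI)
    fix r :: real and x assume r: "r > 0" and x: "x \<notin> (*\<^sub>R) r ` K"
    show "star_norm K x > r"
    proof (rule ccontr)
      assume le: "\<not> star_norm K x > r"
      obtain k where k: "k \<in> K" "x = star_norm K x *\<^sub>R k" "0 \<le> star_norm K x"
        using star_norm_min(1)[OF K, of x] by auto
      have "star_norm K x / r \<in> {0..1}" using le r k(3) by auto
      then have "(star_norm K x / r) *\<^sub>R k \<in> K" using s k(1) by blast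
      moreover have "x = r *\<^sub>R ((star_norm K x / r) *\<^sub>R k)" using k(2) r by simp
      ultimately show False using x by blast
    qed
  next
    fix r :: real and x assume r: "r > 0" and x: "star_norm K x > r"
    then show "x \<notin> (*\<^sub>R) r ` K" using star_norm_min(2)[OF K, of r x] by auto
  qed
qed

definition star_body :: "(real ^ 'n) set \<Rightarrow> bool" where
  "star_body K \<longleftrightarrow> compact K \<and> 0 \<in> interior K \<and> starlike_origin K"

definition lattice_min :: "(real ^ 'n) set \<Rightarrow> (real ^ 'n) set \<Rightarrow> real" where
  "lattice_min K L = (INF l\<in>L - {0}. star_norm K l)"

definition cover_radius :: "(real ^ 'n) set \<Rightarrow> (real ^ 'n) set \<Rightarrow> ereal" where
  "cover_radius K L = (SUP v. ereal (INF l\<in>L. star_norm K (l - v)))"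

text \<open>The inner infimum in \<open>cover_radius\<close> and the infimum in \<open>lattice_min\<close> are minima, as lattices
  are locally finite; the supremum over \<open>v\<close> is taken in the extended reals.\<close>

lemma lattice_cball_finite:
  fixes L :: "(real ^ 'n) set"
  assumes "is_lattice L"
  shows "finite (L \<inter> cball 0 R)"
proof -
  obtain B where B: "independent B" "span B = UNIV"
    and L: "L = {\<Sum>b\<in>B. of_int (c b) *\<^sub>R b | c :: real ^ 'n \<Rightarrow> int. True}"
    using assms unfolding is_lattice_def by blast
  have fin: "finite B" using B(1) by (rule independent_imp_finite)
  have lin: "linear (\<lambda>v. representation B v b)" for b
    by (rule linearI) (simp_all add: B representation_add representation_scale)
  have "\<exists>M. \<forall>b\<in>B. \<forall>v. \<bar>representation B v b\<bar> \<le> M b * norm v"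
  proof -
    have "\<forall>b. \<exists>M. \<forall>v. \<bar>representation B v b\<bar> \<le> M * norm v"
      using linear_bounded[OF lin] by auto
    then show ?thesis by metis
  qed
  then obtain M where M: "\<And>b v. b \<in> B \<Longrightarrow> \<bar>representation B v b\<bar> \<le> M b * norm v" by blast
  let ?g = "\<lambda>c. \<Sum>b\<in>B. of_int (c b) *\<^sub>R b"
  let ?C = "PiE B (\<lambda>b. {- \<lceil>\<bar>M b\<bar> * R\<rceil> .. \<lceil>\<bar>M b\<bar> * R\<rceil>})"
  have "L \<inter> cball 0 R \<subseteq> ?g ` ?C"
  proof
    fix v assume v: "v \<in> L \<inter> cball 0 R"
    then obtain c where c: "v = ?g c" unfolding L by blast
    have rep: "representation B v b = of_int (c b)" if "b \<in> B" for b
    proof -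
      have "representation B v b = (\<Sum>a\<in>B. of_int (c a) * representation B a b)"
        unfolding c by (simp add: linear_sum[OF lin] linear_scale[OF lin])
      also have "\<dots> = (\<Sum>a\<in>B. if a = b then of_int (c a) else 0)"
        by (rule sum.cong) (auto simp: representation_basis B)
      finally show ?thesis using that fin by simp
    qed
    have bound: "\<bar>real_of_int (c b)\<bar> \<le> \<bar>M b\<bar> * R" if "b \<in> B" for b
    proof -
      have "\<bar>real_of_int (c b)\<bar> \<le> M b * norm v" using M[OF that, of v] rep[OF that] by simp
      also have "\<dots> \<le> \<bar>M b\<bar> * R" using v by (intro mult_mono) auto
      finally show ?thesis .
    qed
    have "c b \<in> {- \<lceil>\<bar>M b\<bar> * R\<rceil> .. \<lceil>\<bar>M b\<bar> * R\<rceil>}" if "b \<in> B" for b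
    proof -
      have "real_of_int \<bar>c b\<bar> \<le> of_int \<lceil>\<bar>M b\<bar> * R\<rceil>"
        using bound[OF that] le_of_int_ceiling[of "\<bar>M b\<bar> * R"] by linarith
      then have "\<bar>c b\<bar> \<le> \<lceil>\<bar>M b\<bar> * R\<rceil>" by (simp only: of_int_le_iff)
      then show ?thesis by auto
    qed
    then have "restrict c B \<in> ?C" by (simp only: restrict_PiE_iff) blast
    moreover have "v = ?g (restrict c B)" unfolding c by (rule sum.cong) auto
    ultimately show "v \<in> ?g ` ?C" by blast
  qed
  then show ?thesis by (rule finite_subset) (intro finite_imageI finite_PiE fin, auto)
qed

lemma star_norm_attains_INF:
  fixes L A :: "(real ^ 'n) set"
  assumes K: "compact K" "0 \<in> interior K" and L: "is_lattice L" and A: "A \<subseteq> L" "A \<noteq> {}"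
  shows "\<exists>l\<in>A. (INF l\<in>A. star_norm K (l - v)) = star_norm K (l - v)"
proof -
  obtain D where D: "D > 0" "\<And>k. k \<in> K \<Longrightarrow> norm k \<le> D"
    using compact_imp_bounded[OF K(1)] unfolding bounded_pos by blast
  obtain a where a: "a \<in> A" using A by blast
  let ?s = "\<lambda>l. star_norm K (l - v)"
  let ?F = "{l\<in>A. ?s l \<le> ?s a}"
  have "norm l \<le> ?s a * D + norm v" if "l \<in> ?F" for l
  proof -
    obtain k where k: "k \<in> K" "l - v = ?s l *\<^sub>R k" "0 \<le> ?s l"
      using star_norm_min(1)[OF K, of "l - v"] by auto
    have "norm (l - v) = ?s l * norm k" using k(3) by (subst k(2)) simp
    also have "\<dots> \<le> ?s a * D" using that k D by (intro mult_mono) auto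
    finally show ?thesis using norm_triangle_sub[of l v] by linarith
  qed
  then have "?F \<subseteq> L \<inter> cball 0 (?s a * D + norm v)" using A by auto
  then have fin: "finite ?F" using lattice_cball_finite[OF L] finite_subset by blast
  have "a \<in> ?F" using a by simp
  then obtain l where l: "l \<in> ?F" "\<And>m. m \<in> ?F \<Longrightarrow> ?s l \<le> ?s m"
    using arg_min_if_finite(1)[OF fin, of ?s] arg_min_least[OF fin, of _ ?s] by blast
  have "?s l \<le> ?s m" if "m \<in> A" for m
    using l(2)[of m] l(1) that by (cases "?s m \<le> ?s a") auto
  then have "(INF l\<in>A. ?s l) = ?s l"
    using l(1) by (intro cInf_eq_minimum) auto
  then show ?thesis using l(1) by blast
qed

text \<open>Required of both \<open>f\<close> and its Fourier transform; the exponent \<open>\<delta>\<close> may differ between them.\<close>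

definition admissible :: "(real ^ 'n \<Rightarrow> real) \<Rightarrow> bool" where
  "admissible h \<longleftrightarrow>
     continuous_on UNIV h \<and>
     (\<exists>\<delta>>0. \<exists>C. \<forall>x. \<bar>h x\<bar> \<le> C * (1 + norm x) powr (- real CARD('n) - \<delta>)) \<and>
     (\<forall>L t. is_lattice L \<longrightarrow> t > 0 \<longrightarrow>
        (\<lambda>l. cmod (fourier h (t *\<^sub>R l))) summable_on dual_lattice L) \<and>
     (\<forall>v. fourier h v \<in> \<real>) \<and>
     (\<forall>v t. t \<ge> 1 \<longrightarrow>
        0 \<le> Re (fourier h (t *\<^sub>R v)) \<and> Re (fourier h (t *\<^sub>R v)) \<le> Re (fourier h v))"

end

theory Submission
  imports Defs
begin

text \<open>
  The proof is Banaszczyk's comparison of two Poisson summation formulas. Write \<open>h(A)\<close> for the sum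
  of \<open>h\<close> over \<open>A\<close>, and \<open>D\<close> for the covolume of a lattice \<open>\<Lambda>\<close>.

  If \<open>h\<close> has a nonnegative Fourier transform that decreases along rays, then shifting the lattice
  and spreading \<open>h\<close> out can only decrease the suitably normalised lattice sum:
  \<open>u\<^sup>n \<cdot> \<Sum> h(u(\<lambda> - v)) \<le> h(\<Lambda>)\<close> for \<open>0 < u \<le> 1\<close>. After Poisson summation the shift by \<open>v\<close> only
  inserts phases and the dilation replaces \<open>\<mu>\<close> by \<open>\<mu>/u\<close> (\<open>lattice_sum_affine_le\<close>). Combined with the
  pointwise bound \<open>h(x) \<le> c u\<^sup>n h(ux)\<close> outside \<open>K\<close>, which is what \<open>\<nu>\<^sub>h(K) < c\<close> provides, the part of a
  shifted lattice outside \<open>K\<close> contributes at most \<open>c h(\<Lambda>)\<close> (\<open>lattice_tail_le\<close>).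

  Now suppose that no nonzero point of \<open>\<Lambda>\<close> lies in \<open>K\<close> and that some shift \<open>\<Lambda>\<^sup>* - v\<close> misses \<open>K'\<close>
  altogether. The first condition gives \<open>f(\<Lambda>) - f(0) \<le> \<nu>\<^sub>f(K) f(\<Lambda>)\<close>, so \<open>f(0)\<close> dominates the sum. The
  second bounds the sum of the transform over \<open>\<Lambda>\<^sup>* - v\<close> by \<open>\<nu>(K')\<close> times its sum over \<open>\<Lambda>\<^sup>*\<close>, which is
  \<open>D f(\<Lambda>)\<close>. But Poisson summation of \<open>f(x) exp(2\<pi>i v\<cdot>x)\<close> identifies the shifted sum with
  \<open>D \<Sum> f(\<lambda>) exp(2\<pi>i v\<cdot>\<lambda>) \<ge> D (2 f(0) - f(\<Lambda>))\<close>. Together these inequalities force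
  \<open>1 \<le> 2 \<nu>\<^sub>f(K) + \<nu>(K')\<close> (\<open>transference_alternative\<close>). If \<open>\<sigma> \<rho> > 1\<close>, a dilate of the lattice has both
  properties, and this contradicts the hypothesis.

  Of the transform of \<open>fhat\<close> only sign and monotonicity enter, never its value, so Fourier inversion
  is not involved. Poisson summation itself (\<open>poisson_summation\<close>) is proved for an arbitrary lattice without
  linear changes of variable: the space is tiled by the translates of a fundamental cell, so only
  translation invariance of Lebesgue measure is used. The periodization of \<open>g\<close> and the series formed
  from its transform are continuous with the same Fourier coefficients on the cell, and a continuous
  function whose coefficients all vanish is \<open>0\<close> at the origin (\<open>vanishing_coefficients\<close>).

  Lattice sums are written as integrals over counting measure, which makes Fubini's theorem and
  dominated convergence available for them.
\<close>

section \<open>Polynomial decay\<close>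

text \<open>
  The one estimate behind all changes of argument in a decay bound: if the arguments, increased by
  \<open>1\<close>, are comparable up to a factor \<open>M\<close>, the decay factors are comparable up to \<open>M\<^sup>s\<close>.
\<close>

lemma powr_decay_shift:
  fixes s M a b :: real
  assumes "0 \<le> s" "1 \<le> a" "0 < b" "a \<le> M * b"
  shows "b powr (-s) \<le> M powr s * a powr (-s)"
proof -
  have "0 < M * b" using assms by linarith
  then have M: "0 < M" using assms(3) by (rule zero_less_mult_pos2)
  have "a powr s \<le> (M * b) powr s"
    using assms by (intro powr_mono2) auto
  also have "\<dots> = M powr s * b powr s"
    using M assms by (simp add: powr_mult)
  finally have le: "a powr s \<le> M powr s * b powr s" .
  have inv: "x powr s * x powr (-s) = 1" if "0 < x" for x :: real
    using that by (simp flip: powr_add)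
  have "a powr s * (a powr (-s) * b powr (-s)) \<le> (M powr s * b powr s) * (a powr (-s) * b powr (-s))"
    by (rule mult_right_mono[OF le]) simp
  also have "\<dots> = M powr s * a powr (-s) * (b powr s * b powr (-s))" by (simp only: mult_ac)
  also have "a powr s * (a powr (-s) * b powr (-s)) = (a powr s * a powr (-s)) * b powr (-s)"
    by (simp only: mult_ac)
  finally show ?thesis using inv[of a] inv[of b] assms(2,3) by simp
qed

text \<open>
  The constant depends on the shift only through a bound \<open>R\<close> for its norm. This uniformity supplies
  the dominating function in \<open>continuous_periodization\<close>.
\<close>

lemma decay_translate:
  fixes g :: "'a::real_normed_vector \<Rightarrow> 'b::real_normed_vector"
  assumes s: "s \<ge> 0" and g: "\<And>x. norm (g x) \<le> C * (1 + norm x) powr (-s)" and v: "norm v \<le> R"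
  shows "norm (g (x + v)) \<le> (\<bar>C\<bar> * (1 + R) powr s) * (1 + norm x) powr (-s)"
proof -
  have R: "R \<ge> 0" using v norm_ge_zero order_trans by blast
  have "norm x \<le> norm (x + v) + R"
    using norm_triangle_ineq4[of "x + v" v] v by simp
  moreover have "0 \<le> R * norm (x + v)" using R by simp
  ultimately have "1 + norm x \<le> (1 + R) * (1 + norm (x + v))" by (simp add: algebra_simps)
  then have "(1 + norm (x + v)) powr (-s) \<le> (1 + R) powr s * (1 + norm x) powr (-s)"
    using s by (intro powr_decay_shift) (auto intro: add_pos_nonneg)
  then have "\<bar>C\<bar> * (1 + norm (x + v)) powr (-s) \<le> \<bar>C\<bar> * ((1 + R) powr s * (1 + norm x) powr (-s))"
    by (rule mult_left_mono) simp
  moreover have "norm (g (x + v)) \<le> \<bar>C\<bar> * (1 + norm (x + v)) powr (-s)"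
    by (rule order_trans[OF g]) (intro mult_right_mono, auto)
  ultimately show ?thesis by (simp add: mult.assoc)
qed

text \<open>
  The dyadic shell \<open>2\<^sup>k \<le> 1 + norm x < 2\<^sup>k\<^sup>+\<^sup>1\<close> lies in a ball of volume proportional to \<open>2\<^sup>k\<^sup>n\<close>, and
  the integrand there is at most \<open>2\<^sup>-\<^sup>s\<^sup>k\<close>; the resulting geometric series has ratio \<open>2\<^sup>n\<^sup>-\<^sup>s < 1\<close>.
\<close>

lemma integrable_powr_decay:
  fixes s :: real
  assumes s: "s > DIM('a)"
  shows "integrable lborel (\<lambda>x::'a::euclidean_space. (1 + norm x) powr (-s))"
proof (rule integrableI_bounded)
  show "(\<lambda>x::'a. (1 + norm x) powr (-s)) \<in> borel_measurable lborel"
    by measurable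
  define n where "n = DIM('a)"
  define V where "V = unit_ball_vol (real n)"
  have V: "V \<ge> 0" by (simp add: V_def)
  define q where "q = 2 powr (real n - s)"
  have q: "0 < q" "q < 1"
    using s by (auto simp: q_def n_def powr_less_one)
  have dom: "ennreal (norm ((1 + norm x) powr (-s))) \<le>
      (\<Sum>k. ennreal (2 powr (- s * real k)) * indicator (ball 0 (2 ^ Suc k)) x)" for x :: 'a
  proof -
    \<comment> \<open>the index of the dyadic shell containing \<open>x\<close>\<close>
    define k where "k = nat \<lfloor>log 2 (1 + norm x)\<rfloor>"
    have nn: "0 \<le> log 2 (1 + norm x)" by (subst zero_le_log_cancel_iff) (auto intro: add_pos_nonneg)
    have k1: "real k \<le> log 2 (1 + norm x)" "log 2 (1 + norm x) < real (Suc k)"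
      using nn by (auto simp: k_def) linarith+
    have k2: "2 powr real k \<le> 1 + norm x"
      using k1(1) by (subst (asm) le_log_iff) (auto intro: add_pos_nonneg)
    have "1 + norm x < 2 powr real (Suc k)"
      using k1(2) by (subst (asm) log_less_iff) (auto intro: add_pos_nonneg)
    then have k3: "norm x < 2 ^ Suc k"
      by (subst (asm) powr_realpow) auto
    have "(1 + norm x) powr (-s) \<le> (2 powr real k) powr (-s)"
      using k2 s by (intro powr_mono2') auto
    then have "(1 + norm x) powr (-s) \<le> 2 powr (- s * real k)"
      by (simp add: powr_powr mult.commute)
    then have "ennreal (norm ((1 + norm x) powr (-s))) \<le>
        ennreal (2 powr (- s * real k)) * indicator (ball 0 (2 ^ Suc k)) x"
      using k3 by (simp add: ennreal_leI)
    also have "\<dots> = (\<Sum>j\<in>{k}. ennreal (2 powr (- s * real j)) * indicator (ball 0 (2 ^ Suc j)) x)"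
      by (subst sum.insert) (simp_all only: finite.emptyI sum.empty add_0_right empty_iff not_False_eq_True)
    also have "\<dots> \<le> (\<Sum>j. ennreal (2 powr (- s * real j)) * indicator (ball 0 (2 ^ Suc j)) x)"
      by (rule sum_le_suminf) auto
    finally show ?thesis .
  qed
  have shell: "ennreal (2 powr (- s * real k)) * emeasure lborel (ball (0::'a) (2 ^ Suc k))
      = ennreal (V * 2 ^ n * q ^ k)" for k
  proof -
    have "2 powr (- s * real k) * (V * (2 ^ Suc k) ^ n) = V * 2 ^ n * q ^ k"
    proof -
      have "q ^ k = 2 powr ((real n - s) * real k)"
        by (simp add: q_def powr_powr flip: powr_realpow)
      also have "\<dots> = 2 powr (- s * real k) * 2 powr (real (k * n))"
        by (simp add: algebra_simps flip: powr_add)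
      also have "2 powr (real (k * n)) = (2 ^ k) ^ n"
        by (subst powr_realpow) (auto simp: power_mult)
      finally show ?thesis by (simp add: power_mult_distrib)
    qed
    moreover have "emeasure lborel (ball (0::'a) (2 ^ Suc k)) = ennreal (V * (2 ^ Suc k) ^ n)"
      by (simp add: emeasure_ball n_def V_def)
    moreover have "ennreal (2 powr (- s * real k)) * ennreal (V * (2 ^ Suc k) ^ n)
        = ennreal (2 powr (- s * real k) * (V * (2 ^ Suc k) ^ n))"
      using V by (intro ennreal_mult[symmetric]) auto
    ultimately show ?thesis by (simp only:)
  qed
  define w where "w k x = ennreal (2 powr (- s * real k)) * indicator (ball (0::'a) (2 ^ Suc k)) x" for k x
  have [measurable]: "w k \<in> borel_measurable lborel" for k
    unfolding w_def by (intro borel_measurable_times_ennreal borel_measurable_const borel_measurable_indicator) simp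
  have w: "(\<integral>\<^sup>+x. w k x \<partial>lborel) = ennreal (V * 2 ^ n * q ^ k)" for k
    unfolding w_def shell[symmetric] by (rule nn_integral_cmult_indicator) simp
  have "(\<integral>\<^sup>+x. ennreal (norm ((1 + norm (x::'a)) powr (-s))) \<partial>lborel) \<le>
      (\<integral>\<^sup>+x. (\<Sum>k. w k x) \<partial>lborel)"
    unfolding w_def by (rule nn_integral_mono) (rule dom)
  also have "\<dots> = (\<Sum>k. \<integral>\<^sup>+x. w k x \<partial>lborel)"
    by (rule nn_integral_suminf) fact
  also have "\<dots> = ennreal (\<Sum>k. V * 2 ^ n * q ^ k)"
    unfolding w using q V
    by (intro suminf_ennreal2 summable_mult summable_geometric mult_nonneg_nonneg zero_le_power) auto
  also have "\<dots> < \<infinity>" by simp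
  finally show "(\<integral>\<^sup>+x. ennreal (norm ((1 + norm (x::'a)) powr (-s))) \<partial>lborel) < \<infinity>" .
qed

section \<open>Bases, dual bases and the fundamental cell\<close>

locale lattice_basis =
  fixes B :: "(real ^ 'n) set"
  assumes indep: "independent B" and spanning: "span B = UNIV"
begin

definition int_span :: "(real ^ 'n) set" where
  "int_span = {\<Sum>b\<in>B. of_int (c b) *\<^sub>R b | c :: real ^ 'n \<Rightarrow> int. True}"

text \<open>
  The vector representing the coordinate functional of \<open>b\<close>, so \<open>dual_vec ` B\<close> is the dual basis of \<open>B\<close>.
\<close>

definition dual_vec :: "real ^ 'n \<Rightarrow> real ^ 'n" where
  "dual_vec b = (\<Sum>i\<in>Basis. representation B i b *\<^sub>R i)"

lemma finite_B: "finite B"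
  using indep by (rule independent_imp_finite)

lemma B_nonempty: "B \<noteq> {}"
proof
  assume "B = {}"
  then have "(UNIV :: (real ^ 'n) set) = {0}" using spanning by simp
  then show False using UNIV_not_singleton by blast
qed

lemma dual_vec_inner: "dual_vec b \<bullet> x = representation B x b"
proof -
  have lin: "linear (\<lambda>v. representation B v b)"
    by (rule linearI) (simp_all add: indep spanning representation_add representation_scale)
  have "representation B x b = representation B (\<Sum>i\<in>Basis. (x \<bullet> i) *\<^sub>R i) b"
    by (simp add: euclidean_representation)
  also have "\<dots> = (\<Sum>i\<in>Basis. (x \<bullet> i) * representation B i b)"
    by (simp add: linear_sum[OF lin] linear_scale[OF lin])
  also have "\<dots> = dual_vec b \<bullet> x"
    by (simp add: dual_vec_def inner_sum_right inner_commute[of _ x] mult.commute)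
  finally show ?thesis by simp
qed

lemma dual_vec_basis:
  assumes "b \<in> B" "a \<in> B"
  shows "dual_vec b \<bullet> a = (if a = b then 1 else 0)"
  using assms by (auto simp: dual_vec_inner representation_basis indep)

lemma basis_expansion: "(\<Sum>b\<in>B. (dual_vec b \<bullet> x) *\<^sub>R b) = x"
  unfolding dual_vec_inner
  by (rule sum_representation_eq) (auto simp: indep spanning finite_B)

lemma dual_expansion: "(\<Sum>b\<in>B. (y \<bullet> b) *\<^sub>R dual_vec b) = y"
proof (rule vector_eq_rdot[THEN iffD1], intro allI)
  fix x
  have "y \<bullet> x = y \<bullet> (\<Sum>b\<in>B. (dual_vec b \<bullet> x) *\<^sub>R b)"
    by (simp only: basis_expansion)
  also have "\<dots> = (\<Sum>b\<in>B. (y \<bullet> b) *\<^sub>R dual_vec b) \<bullet> x"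
    by (simp add: inner_sum_left inner_sum_right mult.commute)
  finally show "(\<Sum>b\<in>B. (y \<bullet> b) *\<^sub>R dual_vec b) \<bullet> x = y \<bullet> x" by (rule sym)
qed

lemma coords_of_combination:
  assumes "b \<in> B"
  shows "dual_vec b \<bullet> (\<Sum>a\<in>B. r a *\<^sub>R a) = r b"
proof -
  have "dual_vec b \<bullet> (\<Sum>a\<in>B. r a *\<^sub>R a) = (\<Sum>a\<in>B. if a = b then r a else 0)"
    unfolding inner_sum_right by (rule sum.cong) (auto simp: dual_vec_basis assms)
  then show ?thesis using assms finite_B by simp
qed

lemma int_span_iff: "x \<in> int_span \<longleftrightarrow> (\<forall>b\<in>B. dual_vec b \<bullet> x \<in> \<int>)"
proof
  assume "x \<in> int_span"
  then show "\<forall>b\<in>B. dual_vec b \<bullet> x \<in> \<int>"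
    by (auto simp: int_span_def coords_of_combination)
next
  assume "\<forall>b\<in>B. dual_vec b \<bullet> x \<in> \<int>"
  then have c: "dual_vec b \<bullet> x = of_int \<lfloor>dual_vec b \<bullet> x\<rfloor>" if "b \<in> B" for b
    using that by (fastforce elim: Ints_cases)
  have "x = (\<Sum>b\<in>B. (dual_vec b \<bullet> x) *\<^sub>R b)" by (simp only: basis_expansion)
  also have "\<dots> = (\<Sum>b\<in>B. of_int \<lfloor>dual_vec b \<bullet> x\<rfloor> *\<^sub>R b)"
    by (rule sum.cong) (simp_all flip: c)
  finally show "x \<in> int_span"
    unfolding int_span_def by (auto intro: exI[of _ "\<lambda>b. \<lfloor>dual_vec b \<bullet> x\<rfloor>"])
qed

lemma dual_iff: "y \<in> dual_lattice int_span \<longleftrightarrow> (\<forall>b\<in>B. y \<bullet> b \<in> \<int>)"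
proof
  assume y: "y \<in> dual_lattice int_span"
  have "b \<in> int_span" if "b \<in> B" for b
    using that by (simp add: int_span_iff dual_vec_basis)
  then show "\<forall>b\<in>B. y \<bullet> b \<in> \<int>" using y by (simp add: dual_lattice_def)
next
  assume y: "\<forall>b\<in>B. y \<bullet> b \<in> \<int>"
  have "y \<bullet> x \<in> \<int>" if x: "x \<in> int_span" for x
  proof -
    have "y \<bullet> x = y \<bullet> (\<Sum>b\<in>B. (dual_vec b \<bullet> x) *\<^sub>R b)" by (simp only: basis_expansion)
    also have "\<dots> = (\<Sum>b\<in>B. (dual_vec b \<bullet> x) * (y \<bullet> b))"
      by (simp add: inner_sum_right)
    also have "\<dots> \<in> \<int>"
      using y x unfolding int_span_iff by (intro Ints_sum Ints_mult) blast+
    finally show ?thesis .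
  qed
  then show "y \<in> dual_lattice int_span" by (simp add: dual_lattice_def)
qed

lemma is_lattice_int_span: "is_lattice int_span"
  unfolding is_lattice_def int_span_def using indep spanning by blast

lemma int_span_group:
  "0 \<in> int_span"
  "x \<in> int_span \<Longrightarrow> y \<in> int_span \<Longrightarrow> x + y \<in> int_span"
  "x \<in> int_span \<Longrightarrow> - x \<in> int_span"
  by (simp_all add: int_span_iff inner_add_right)

lemma dual_group:
  "x \<in> dual_lattice int_span \<Longrightarrow> y \<in> dual_lattice int_span \<Longrightarrow> x + y \<in> dual_lattice int_span"
  "x \<in> dual_lattice int_span \<Longrightarrow> - x \<in> dual_lattice int_span"
  by (simp_all add: dual_iff inner_add_left)

lemma dual_vec_in_dual: "b \<in> B \<Longrightarrow> dual_vec b \<in> dual_lattice int_span"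
  by (auto simp: dual_iff dual_vec_basis)

lemma inj_dual_vec: "inj_on dual_vec B"
proof (rule inj_onI)
  fix a b assume ab: "a \<in> B" "b \<in> B" "dual_vec a = dual_vec b"
  have "(if b = a then 1 else 0) = (1::real)"
    using dual_vec_basis[OF ab(1,2)] dual_vec_basis[OF ab(2,2)] ab(3) by simp
  then show "a = b" by (metis zero_neq_one)
qed

lemma span_dual_vec: "span (dual_vec ` B) = UNIV"
proof -
  have mem: "y \<in> span (dual_vec ` B)" for y
  proof -
    have "(\<Sum>b\<in>B. (y \<bullet> b) *\<^sub>R dual_vec b) \<in> span (dual_vec ` B)"
    proof (rule span_sum)
      fix b assume "b \<in> B"
      then show "(y \<bullet> b) *\<^sub>R dual_vec b \<in> span (dual_vec ` B)"
        by (rule span_scale[OF span_base[OF imageI]])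
    qed
    then show ?thesis unfolding dual_expansion .
  qed
  show ?thesis
    by (rule UNIV_eq_I[symmetric]) (rule mem)
qed

lemma independent_dual_vec: "independent (dual_vec ` B)"
proof (rule card_le_dim_spanning)
  have "dim (UNIV :: (real ^ 'n) set) = card B"
    using dim_span_eq_card_independent[OF indep] unfolding spanning .
  then show "card (dual_vec ` B) \<le> dim (UNIV :: (real ^ 'n) set)"
    using card_image_le[OF finite_B, of dual_vec] by linarith
  show "UNIV \<subseteq> span (dual_vec ` B)" unfolding span_dual_vec by (rule order_refl)
qed (rule subset_UNIV, rule finite_imageI[OF finite_B])

lemma dual_basis: "lattice_basis (dual_vec ` B)"
  by (rule lattice_basis.intro[OF independent_dual_vec span_dual_vec])

text \<open>
  Exhibits the dual lattice as a lattice in its own right. The argument needs this in order to apply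
  the tail estimate to the Fourier transform and the dual lattice.
\<close>

lemma dual_eq_int_span: "dual_lattice int_span = lattice_basis.int_span (dual_vec ` B)"
proof -
  interpret D: lattice_basis "dual_vec ` B" by (rule dual_basis)
  have "y \<in> D.int_span" if y: "y \<in> dual_lattice int_span" for y
  proof -
    have floor: "of_int \<lfloor>y \<bullet> b\<rfloor> = y \<bullet> b" if "b \<in> B" for b
      using y that unfolding dual_iff by (metis Ints_cases of_int_floor_cancel)
    define c where "c w = \<lfloor>y \<bullet> inv_into B dual_vec w\<rfloor>" for w
    have "(\<Sum>w\<in>dual_vec ` B. of_int (c w) *\<^sub>R w) = (\<Sum>b\<in>B. (y \<bullet> b) *\<^sub>R dual_vec b)"
      unfolding sum.reindex[OF inj_dual_vec] o_def c_def
      by (rule sum.cong) (simp_all add: inv_into_f_f[OF inj_dual_vec] floor)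
    also have "\<dots> = y" by (rule dual_expansion)
    finally show ?thesis unfolding D.int_span_def by blast
  qed
  moreover have "y \<in> dual_lattice int_span" if mem: "y \<in> D.int_span" for y
  proof -
    obtain c :: "real ^ 'n \<Rightarrow> int" where "y = (\<Sum>w\<in>dual_vec ` B. of_int (c w) *\<^sub>R w)"
      using mem unfolding D.int_span_def by blast
    then have y: "y = (\<Sum>b\<in>B. of_int (c (dual_vec b)) *\<^sub>R dual_vec b)"
      unfolding sum.reindex[OF inj_dual_vec] o_def .
    show ?thesis
      unfolding dual_iff y inner_sum_left
      by (intro ballI Ints_sum) (simp add: dual_vec_basis)
  qed
  ultimately show ?thesis by blast
qed

lemma countable_int_span: "countable int_span"
proof -
  have "int_span = (\<Union>N::nat. int_span \<inter> cball 0 (real N))"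
    using real_arch_simple by (auto simp: dist_norm)
  moreover have "countable (\<Union>N::nat. int_span \<inter> cball 0 (real N))"
    using lattice_cball_finite[OF is_lattice_int_span] by (intro countable_UN) (auto intro: countable_finite)
  ultimately show ?thesis by simp
qed

text \<open>
  Half-open, so that the translates by lattice points partition the space; centred, so that the
  origin is an interior point.
\<close>

definition cell :: "(real ^ 'n) set" where
  "cell = {x. \<forall>b\<in>B. - 1/2 \<le> dual_vec b \<bullet> x \<and> dual_vec b \<bullet> x < 1/2}"

definition closed_cell :: "(real ^ 'n) set" where
  "closed_cell = {x. \<forall>b\<in>B. \<bar>dual_vec b \<bullet> x\<bar> \<le> 1/2}"

lemma cell_subset_closed_cell: "cell \<subseteq> closed_cell"
  by (force simp: cell_def closed_cell_def)

lemma closed_cell_bound: "x \<in> closed_cell \<Longrightarrow> norm x \<le> (\<Sum>b\<in>B. norm b)"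
proof -
  assume x: "x \<in> closed_cell"
  have "norm x = norm (\<Sum>b\<in>B. (dual_vec b \<bullet> x) *\<^sub>R b)" by (simp only: basis_expansion)
  also have "\<dots> \<le> (\<Sum>b\<in>B. norm b)"
    using x by (intro sum_norm_le) (auto simp: closed_cell_def intro!: mult_left_le_one_le dest: bspec)
  finally show ?thesis .
qed

lemma compact_closed_cell: "compact closed_cell"
proof -
  have "closed closed_cell"
    unfolding closed_cell_def Ball_def
    by (intro closed_Collect_all closed_Collect_imp) (auto intro!: closed_Collect_le continuous_intros)
  moreover have "bounded closed_cell"
    unfolding bounded_iff using closed_cell_bound by blast
  ultimately show ?thesis by (simp add: compact_eq_bounded_closed)
qed

lemma cell_borel [measurable]: "cell \<in> sets borel"
proof -
  have "cell = (\<Inter>b\<in>B. {x. - 1/2 \<le> dual_vec b \<bullet> x} \<inter> {x. dual_vec b \<bullet> x < 1/2})"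
    by (auto simp: cell_def)
  moreover have "{x. - 1/2 \<le> dual_vec b \<bullet> x} \<inter> {x. dual_vec b \<bullet> x < 1/2} \<in> sets borel" for b
    by (intro sets.Int borel_closed borel_open closed_Collect_le open_Collect_less continuous_intros)
  ultimately show ?thesis
    using finite_B B_nonempty by (auto intro!: sets.finite_INT)
qed

lemma ball_subset_cell: "\<exists>r>0. ball 0 r \<subseteq> cell"
proof -
  have "open {x. \<forall>b\<in>B. \<bar>dual_vec b \<bullet> x\<bar> < 1/2}"
  proof -
    have "{x. \<forall>b\<in>B. \<bar>dual_vec b \<bullet> x\<bar> < 1/2} = (\<Inter>b\<in>B. {x. \<bar>dual_vec b \<bullet> x\<bar> < 1/2})"
      by auto
    then show ?thesis
      using finite_B by (auto intro!: open_INT open_Collect_less continuous_intros)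
  qed
  then obtain r where "r > 0" "ball 0 r \<subseteq> {x. \<forall>b\<in>B. \<bar>dual_vec b \<bullet> x\<bar> < 1/2}"
    by (rule openE[of _ 0]) auto
  moreover have "{x. \<forall>b\<in>B. \<bar>dual_vec b \<bullet> x\<bar> < 1/2} \<subseteq> cell"
    by (force simp: cell_def)
  ultimately show ?thesis by blast
qed

lemma cell_finite: "emeasure lborel cell < \<infinity>"
proof -
  have "emeasure lborel cell \<le> emeasure lborel closed_cell"
    using cell_subset_closed_cell compact_closed_cell
    by (intro emeasure_mono) (auto intro: borel_closed compact_imp_closed)
  also have "\<dots> < \<infinity>"
    using compact_closed_cell by (intro emeasure_bounded_finite compact_imp_bounded)
  finally show ?thesis .
qed

definition covol :: real where "covol = measure lborel cell"

lemma covol_pos: "covol > 0"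
proof -
  obtain r where r: "r > 0" "ball 0 r \<subseteq> cell" using ball_subset_cell by blast
  have "0 < measure lborel (ball (0 :: real ^ 'n) r)"
    using r(1) by (simp add: content_ball)
  also have "\<dots> \<le> covol"
    unfolding covol_def using r(2) cell_finite
    by (intro measure_mono_fmeasurable) (auto simp: fmeasurable_def)
  finally show ?thesis .
qed

text \<open>
  Rounding each coordinate of \<open>x\<close> to the nearest integer gives the lattice point.
\<close>

lemma cell_translate_unique: "\<exists>!l. l \<in> int_span \<and> x - l \<in> cell"
proof (rule ex1I)
  define l where "l = (\<Sum>b\<in>B. of_int \<lfloor>dual_vec b \<bullet> x + 1/2\<rfloor> *\<^sub>R b)"
  have lb: "dual_vec b \<bullet> l = of_int \<lfloor>dual_vec b \<bullet> x + 1/2\<rfloor>" if "b \<in> B" for b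
    unfolding l_def using that by (rule coords_of_combination)
  have "- 1/2 \<le> dual_vec b \<bullet> (x - l) \<and> dual_vec b \<bullet> (x - l) < 1/2" if "b \<in> B" for b
    using lb[OF that] floor_correct[of "dual_vec b \<bullet> x + 1/2"] by (simp add: inner_diff_right; linarith)
  then show "l \<in> int_span \<and> x - l \<in> cell"
    by (auto simp: int_span_iff lb cell_def)
  fix m assume m: "m \<in> int_span \<and> x - m \<in> cell"
  have "dual_vec b \<bullet> m = dual_vec b \<bullet> l" if b: "b \<in> B" for b
  proof -
    obtain k where k: "dual_vec b \<bullet> m = of_int k"
      using m b by (auto simp: int_span_iff elim: Ints_cases)
    have "- 1/2 \<le> dual_vec b \<bullet> x - of_int k" "dual_vec b \<bullet> x - of_int k < 1/2"
      using m b k by (auto simp: cell_def inner_diff_right)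
    then have "\<lfloor>dual_vec b \<bullet> x + 1/2\<rfloor> = k" by (intro floor_unique) auto
    then show ?thesis using k lb[OF b] by simp
  qed
  then have "(\<Sum>b\<in>B. (dual_vec b \<bullet> m) *\<^sub>R b) = (\<Sum>b\<in>B. (dual_vec b \<bullet> l) *\<^sub>R b)" by simp
  then show "m = l" by (simp only: basis_expansion)
qed

end

section \<open>Folding integrals onto the cell\<close>

lemma nn_integral_lborel_translate:
  fixes F :: "'a::euclidean_space \<Rightarrow> ennreal"
  assumes [measurable]: "F \<in> borel_measurable borel"
  shows "(\<integral>\<^sup>+x. F (x + c) \<partial>lborel) = (\<integral>\<^sup>+x. F x \<partial>lborel)"
proof -
  have "(\<integral>\<^sup>+x. F x \<partial>lborel) = (\<integral>\<^sup>+x. F x \<partial>distr lborel borel ((+) c))"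
    by (simp only: lborel_distr_plus)
  also have "\<dots> = (\<integral>\<^sup>+x. F (c + x) \<partial>lborel)" by (rule nn_integral_distr) measurable
  finally show ?thesis by (simp add: add.commute)
qed

lemma integral_lborel_translate:
  fixes F :: "'a::euclidean_space \<Rightarrow> 'b::{banach,second_countable_topology}"
  assumes [measurable]: "F \<in> borel_measurable borel"
  shows "(\<integral>x. F (x + c) \<partial>lborel) = (\<integral>x. F x \<partial>lborel)"
proof -
  have "(\<integral>x. F x \<partial>lborel) = (\<integral>x. F x \<partial>distr lborel borel ((+) c))"
    by (simp only: lborel_distr_plus)
  also have "\<dots> = (\<integral>x. F (c + x) \<partial>lborel)" by (rule integral_distr) measurable
  finally show ?thesis by (simp add: add.commute)
qed

lemma integral_count_space_swap:
  fixes f :: "'i \<Rightarrow> 'a \<Rightarrow> 'b::{banach,second_countable_topology}"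
  assumes M: "sigma_finite_measure M" and I: "countable I"
    and meas: "\<And>i. i \<in> I \<Longrightarrow> f i \<in> borel_measurable M"
    and fin: "(\<integral>\<^sup>+i. \<integral>\<^sup>+x. ennreal (norm (f i x)) \<partial>M \<partial>count_space I) < \<infinity>"
  shows "(\<integral>x. (\<integral>i. f i x \<partial>count_space I) \<partial>M) = (\<integral>i. (\<integral>x. f i x \<partial>M) \<partial>count_space I)"
proof -
  interpret M: sigma_finite_measure M by fact
  interpret C: sigma_finite_measure "count_space I"
    by (rule sigma_finite_measure_count_space_countable[OF I])
  interpret pair_sigma_finite "count_space I" M ..
  have m: "case_prod f \<in> borel_measurable (count_space I \<Otimes>\<^sub>M M)"
    using I meas by (intro measurable_pair_measure_countable1) auto
  then have mn: "(\<lambda>p. ennreal (norm (case_prod f p))) \<in> borel_measurable (count_space I \<Otimes>\<^sub>M M)"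
    by measurable
  have "integrable (count_space I \<Otimes>\<^sub>M M) (case_prod f)"
  proof (rule integrableI_bounded[OF m])
    show "(\<integral>\<^sup>+p. ennreal (norm (case_prod f p)) \<partial>(count_space I \<Otimes>\<^sub>M M)) < \<infinity>"
      using fin unfolding M.nn_integral_fst[OF mn, symmetric] by simp
  qed
  then show ?thesis by (rule Fubini_integral)
qed

lemma nn_integral_count_space_single:
  assumes "a \<in> A" "\<And>l. l \<in> A \<Longrightarrow> l \<noteq> a \<Longrightarrow> g l = 0"
  shows "(\<integral>\<^sup>+l. g l \<partial>count_space A) = g a"
proof -
  have "(\<integral>\<^sup>+l. g l \<partial>count_space A) = (\<Sum>l\<in>{a}. g l)"
    using assms by (intro nn_integral_count_space') auto
  then show ?thesis by simp
qed

lemma integral_count_space_single: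
  fixes g :: "'i \<Rightarrow> 'b::{banach,second_countable_topology}"
  assumes "a \<in> A" "\<And>l. l \<in> A \<Longrightarrow> l \<noteq> a \<Longrightarrow> g l = 0"
  shows "(\<integral>l. g l \<partial>count_space A) = g a"
proof -
  have sub: "{l\<in>A. g l \<noteq> 0} \<subseteq> {a}" using assms by auto
  then have "(\<integral>l. g l \<partial>count_space A) = (\<Sum>l | l \<in> A \<and> g l \<noteq> 0. g l)"
    by (intro lebesgue_integral_count_space_finite_support) (rule finite_subset, auto)
  also have "\<dots> = (\<Sum>l\<in>{a}. g l)"
    using sub assms(1) by (intro sum.mono_neutral_left) auto
  finally show ?thesis by simp
qed

context lattice_basis
begin

text \<open>
  Split the space into the translates of the cell: weight \<open>F x\<close> by the indicators of all translates,
  which sum to \<open>1\<close>, exchange sum and integral, and move each translate back to the cell.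
\<close>

lemma nn_integral_unfold:
  fixes F :: "real ^ 'n \<Rightarrow> ennreal"
  assumes [measurable]: "F \<in> borel_measurable borel"
  shows "(\<integral>\<^sup>+x. F x \<partial>lborel) =
    (\<integral>\<^sup>+x. (\<integral>\<^sup>+l. F (x + l) \<partial>count_space int_span) * indicator cell x \<partial>lborel)"
proof -
  have one: "(\<integral>\<^sup>+l. F x * indicator cell (x - l) \<partial>count_space int_span) = F x" for x
  proof -
    obtain a where a: "a \<in> int_span" "x - a \<in> cell" "\<And>l. l \<in> int_span \<Longrightarrow> x - l \<in> cell \<Longrightarrow> l = a"
      using cell_translate_unique[of x] by blast
    have "(\<integral>\<^sup>+l. F x * indicator cell (x - l) \<partial>count_space int_span) = F x * indicator cell (x - a)"
    proof (rule nn_integral_count_space_single[OF a(1)])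
      fix l assume "l \<in> int_span" "l \<noteq> a"
      then have "x - l \<notin> cell" using a(3) by blast
      then show "F x * indicator cell (x - l) = 0" by simp
    qed
    then show ?thesis using a(2) by simp
  qed
  have meas: "(\<lambda>x. F x * indicator cell (x - l)) \<in> borel_measurable lborel"
    "(\<lambda>x. F (x + l) * indicator cell x) \<in> borel_measurable lborel" for l
    by measurable
  have "(\<integral>\<^sup>+x. F x \<partial>lborel) = (\<integral>\<^sup>+x. \<integral>\<^sup>+l. F x * indicator cell (x - l) \<partial>count_space int_span \<partial>lborel)"
    by (simp only: one)
  also have "\<dots> = (\<integral>\<^sup>+l. \<integral>\<^sup>+x. F x * indicator cell (x - l) \<partial>lborel \<partial>count_space int_span)"
    by (rule nn_integral_count_space_nn_integral[OF countable_int_span]) (rule meas)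
  also have "\<dots> = (\<integral>\<^sup>+l. \<integral>\<^sup>+x. F (x + l) * indicator cell x \<partial>lborel \<partial>count_space int_span)"
  proof (rule nn_integral_cong)
    fix l :: "real ^ 'n"
    have "(\<lambda>x. F x * indicator cell (x - l)) \<in> borel_measurable borel" by measurable
    from nn_integral_lborel_translate[OF this, of l]
    show "(\<integral>\<^sup>+x. F x * indicator cell (x - l) \<partial>lborel) = (\<integral>\<^sup>+x. F (x + l) * indicator cell x \<partial>lborel)"
      by simp
  qed
  also have "\<dots> = (\<integral>\<^sup>+x. \<integral>\<^sup>+l. F (x + l) * indicator cell x \<partial>count_space int_span \<partial>lborel)"
    by (rule nn_integral_count_space_nn_integral[OF countable_int_span, symmetric]) (rule meas)
  also have "\<dots> = (\<integral>\<^sup>+x. (\<integral>\<^sup>+l. F (x + l) \<partial>count_space int_span) * indicator cell x \<partial>lborel)"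
    by (intro nn_integral_cong nn_integral_multc) simp
  finally show ?thesis .
qed

lemma integral_unfold:
  fixes g :: "real ^ 'n \<Rightarrow> complex"
  assumes g: "integrable lborel g"
  shows "(\<integral>x. g x \<partial>lborel) = (\<integral>x. indicator cell x *\<^sub>R (\<integral>l. g (x + l) \<partial>count_space int_span) \<partial>lborel)"
proof -
  have [measurable]: "g \<in> borel_measurable borel" using g by auto
  have fin: "(\<integral>\<^sup>+x. ennreal (norm (g x)) \<partial>lborel) < \<infinity>"
    using g by (simp add: integrable_iff_bounded)
  have one: "(\<integral>l. indicator cell (x - l) *\<^sub>R g x \<partial>count_space int_span) = g x" for x
  proof -
    obtain a where a: "a \<in> int_span" "x - a \<in> cell" "\<And>l. l \<in> int_span \<Longrightarrow> x - l \<in> cell \<Longrightarrow> l = a"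
      using cell_translate_unique[of x] by blast
    have "(\<integral>l. indicator cell (x - l) *\<^sub>R g x \<partial>count_space int_span) = indicator cell (x - a) *\<^sub>R g x"
    proof (rule integral_count_space_single[OF a(1)])
      fix l assume "l \<in> int_span" "l \<noteq> a"
      then have "x - l \<notin> cell" using a(3) by blast
      then show "indicator cell (x - l) *\<^sub>R g x = 0" by simp
    qed
    then show ?thesis using a(2) by simp
  qed
  have tr: "(\<integral>\<^sup>+x. ennreal (norm (indicator cell (x - l) *\<^sub>R g x)) \<partial>lborel) =
      (\<integral>\<^sup>+x. ennreal (norm (indicator cell x *\<^sub>R g (x + l))) \<partial>lborel)" for l
  proof -
    have "(\<lambda>x. ennreal (norm (indicator cell (x - l) *\<^sub>R g x))) \<in> borel_measurable borel" by measurable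
    from nn_integral_lborel_translate[OF this, of l] show ?thesis by simp
  qed
  have fin1: "(\<integral>\<^sup>+l. \<integral>\<^sup>+x. ennreal (norm (indicator cell x *\<^sub>R g (x + l))) \<partial>lborel \<partial>count_space int_span) < \<infinity>"
  proof -
    have "(\<integral>\<^sup>+l. \<integral>\<^sup>+x. ennreal (norm (indicator cell x *\<^sub>R g (x + l))) \<partial>lborel \<partial>count_space int_span)
        = (\<integral>\<^sup>+x. \<integral>\<^sup>+l. ennreal (norm (indicator cell x *\<^sub>R g (x + l))) \<partial>count_space int_span \<partial>lborel)"
      by (rule nn_integral_count_space_nn_integral[OF countable_int_span, symmetric]) measurable
    also have "\<dots> = (\<integral>\<^sup>+x. (\<integral>\<^sup>+l. ennreal (norm (g (x + l))) \<partial>count_space int_span) * indicator cell x \<partial>lborel)"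
      by (intro nn_integral_cong) (auto split: split_indicator)
    also have "\<dots> = (\<integral>\<^sup>+x. ennreal (norm (g x)) \<partial>lborel)"
      by (rule nn_integral_unfold[symmetric]) measurable
    finally show ?thesis using fin by simp
  qed
  have "(\<integral>x. g x \<partial>lborel) = (\<integral>x. (\<integral>l. indicator cell (x - l) *\<^sub>R g x \<partial>count_space int_span) \<partial>lborel)"
    by (simp only: one)
  also have "\<dots> = (\<integral>l. (\<integral>x. indicator cell (x - l) *\<^sub>R g x \<partial>lborel) \<partial>count_space int_span)"
  proof (rule integral_count_space_swap[OF lborel.sigma_finite_measure_axioms countable_int_span])
    show "(\<integral>\<^sup>+l. \<integral>\<^sup>+x. ennreal (norm (indicator cell (x - l) *\<^sub>R g x)) \<partial>lborel \<partial>count_space int_span) < \<infinity>"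
      unfolding tr by (rule fin1)
  qed measurable
  also have "\<dots> = (\<integral>l. (\<integral>x. indicator cell x *\<^sub>R g (x + l) \<partial>lborel) \<partial>count_space int_span)"
  proof (rule Bochner_Integration.integral_cong[OF refl])
    fix l :: "real ^ 'n"
    have "(\<lambda>x. indicator cell (x - l) *\<^sub>R g x) \<in> borel_measurable borel" by measurable
    from integral_lborel_translate[OF this, of l]
    show "(\<integral>x. indicator cell (x - l) *\<^sub>R g x \<partial>lborel) = (\<integral>x. indicator cell x *\<^sub>R g (x + l) \<partial>lborel)"
      by simp
  qed
  also have "\<dots> = (\<integral>x. (\<integral>l. indicator cell x *\<^sub>R g (x + l) \<partial>count_space int_span) \<partial>lborel)"
    by (rule integral_count_space_swap[OF lborel.sigma_finite_measure_axioms countable_int_span _ fin1, symmetric])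
      measurable
  also have "\<dots> = (\<integral>x. indicator cell x *\<^sub>R (\<integral>l. g (x + l) \<partial>count_space int_span) \<partial>lborel)"
    by simp
  finally show ?thesis .
qed

text \<open>
  Moving the argument by a point of the cell changes the decay factor by at most a constant factor. The
  lattice sum is thus bounded by the sum of the integrals over the translates of the cell, that is,
  by the integral over the whole space.
\<close>

lemma summable_powr_decay:
  assumes s: "s > real CARD('n)"
  shows "integrable (count_space int_span) (\<lambda>l. (1 + norm l) powr (-s))"
proof (rule integrableI_bounded)
  obtain R where R: "R \<ge> 0" "\<And>x. x \<in> cell \<Longrightarrow> norm x \<le> R"
  proof
    show "0 \<le> (\<Sum>b\<in>B. norm b)" by (simp add: sum_nonneg)
  qed (use closed_cell_bound cell_subset_closed_cell in blast)
  define c where "c = (1 + R) powr s"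
  have c: "c \<ge> 0" by (simp add: c_def)
  let ?I = "\<integral>\<^sup>+l. ennreal (norm ((1 + norm l) powr (-s))) \<partial>count_space int_span"
  have pt: "ennreal (norm ((1 + norm l) powr (-s))) \<le> ennreal c * ennreal (norm ((1 + norm (x + l)) powr (-s)))"
    if "x \<in> cell" for x l
  proof -
    have "1 + norm (x + l) \<le> (1 + R) * (1 + norm l)"
    proof -
      have "norm (x + l) \<le> R + norm l" using norm_triangle_ineq[of x l] R(2)[OF that] by linarith
      moreover have "0 \<le> R * norm l" using R(1) by simp
      ultimately show ?thesis by (simp add: algebra_simps)
    qed
    then have "(1 + norm l) powr (-s) \<le> c * (1 + norm (x + l)) powr (-s)"
      unfolding c_def using s by (intro powr_decay_shift) (auto intro: add_pos_nonneg)
    then show ?thesis using c by (simp add: ennreal_leI flip: ennreal_mult)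
  qed
  have "?I * emeasure lborel cell = (\<integral>\<^sup>+x. ?I * indicator cell x \<partial>lborel)"
    by (rule nn_integral_cmult_indicator[symmetric]) simp
  also have "\<dots> \<le> (\<integral>\<^sup>+x. ennreal c * ((\<integral>\<^sup>+l. ennreal (norm ((1 + norm (x + l)) powr (-s))) \<partial>count_space int_span) * indicator cell x) \<partial>lborel)"
  proof (rule nn_integral_mono)
    fix x
    show "?I * indicator cell x \<le> ennreal c * ((\<integral>\<^sup>+l. ennreal (norm ((1 + norm (x + l)) powr (-s))) \<partial>count_space int_span) * indicator cell x)"
    proof (cases "x \<in> cell")
      case True
      then have "?I \<le> (\<integral>\<^sup>+l. ennreal c * ennreal (norm ((1 + norm (x + l)) powr (-s))) \<partial>count_space int_span)"
        by (intro nn_integral_mono pt)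
      also have "\<dots> = ennreal c * (\<integral>\<^sup>+l. ennreal (norm ((1 + norm (x + l)) powr (-s))) \<partial>count_space int_span)"
        by (rule nn_integral_cmult) simp
      finally show ?thesis using True by simp
    qed simp
  qed
  also have "\<dots> = (\<integral>\<^sup>+x. (\<integral>\<^sup>+l. (ennreal c * ennreal (norm ((1 + norm (x + l)) powr (-s)))) \<partial>count_space int_span) * indicator cell x \<partial>lborel)"
    by (intro nn_integral_cong) (simp add: nn_integral_cmult mult.assoc)
  also have "\<dots> = (\<integral>\<^sup>+x. ennreal c * ennreal (norm ((1 + norm (x::real ^ 'n)) powr (-s))) \<partial>lborel)"
    by (rule nn_integral_unfold[symmetric]) measurable
  also have "\<dots> = ennreal c * (\<integral>\<^sup>+x. ennreal (norm ((1 + norm (x::real ^ 'n)) powr (-s))) \<partial>lborel)"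
    by (rule nn_integral_cmult) measurable
  also have "\<dots> < \<infinity>"
  proof -
    have "integrable lborel (\<lambda>x::real ^ 'n. (1 + norm x) powr (-s))"
      using s by (intro integrable_powr_decay) simp
    then show ?thesis by (simp add: integrable_iff_bounded ennreal_mult_less_top)
  qed
  finally have "?I * emeasure lborel cell < \<infinity>" .
  moreover have "emeasure lborel cell \<noteq> 0"
    using covol_pos by (auto simp: covol_def measure_def)
  ultimately show "?I < \<infinity>"
    by (auto simp: ennreal_mult_less_top)
qed simp

lemma summable_of_decay:
  fixes g :: "real ^ 'n \<Rightarrow> 'b::{banach,second_countable_topology}"
  assumes s: "s > real CARD('n)" and g: "\<And>x. norm (g x) \<le> C * (1 + norm x) powr (-s)"
  shows "integrable (count_space int_span) (\<lambda>l. g l)"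
proof (rule Bochner_Integration.integrable_bound)
  show "integrable (count_space int_span) (\<lambda>l. C * (1 + norm l) powr (-s))"
    by (intro integrable_mult_right summable_powr_decay s)
  show "AE l in count_space int_span. norm (g l) \<le> norm (C * (1 + norm l) powr (-s))"
    using g by (intro AE_I2) (auto intro: order_trans[OF g abs_ge_self])
qed simp

text \<open>
  Dominated convergence along a convergent, hence bounded, sequence of arguments.
\<close>

lemma continuous_periodization:
  fixes g :: "real ^ 'n \<Rightarrow> complex"
  assumes s: "s > real CARD('n)" and g: "\<And>x. norm (g x) \<le> C * (1 + norm x) powr (-s)"
    and cont: "continuous_on UNIV g"
  shows "continuous_on UNIV (\<lambda>x. \<integral>l. g (x + l) \<partial>count_space int_span)"
  unfolding continuous_on_sequentially comp_def
proof (intro allI ballI impI, elim conjE)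
  fix X :: "nat \<Rightarrow> real ^ 'n" and x assume X: "X \<longlonglongrightarrow> x"
  then obtain R where R: "\<And>k. norm (X k) \<le> R"
    using convergent_imp_Bseq[OF convergentI[OF X]] unfolding Bseq_def by blast
  show "(\<lambda>k. \<integral>l. g (X k + l) \<partial>count_space int_span) \<longlonglongrightarrow> (\<integral>l. g (x + l) \<partial>count_space int_span)"
  proof (rule integral_dominated_convergence)
    show "integrable (count_space int_span) (\<lambda>l. (\<bar>C\<bar> * (1 + R) powr s) * (1 + norm l) powr (-s))"
      by (intro integrable_mult_right summable_powr_decay s)
    show "AE l in count_space int_span. (\<lambda>k. g (X k + l)) \<longlonglongrightarrow> g (x + l)"
    proof (rule AE_I2)
      fix l
      have "(\<lambda>k. X k + l) \<longlonglongrightarrow> x + l" using X by (intro tendsto_intros)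
      then show "(\<lambda>k. g (X k + l)) \<longlonglongrightarrow> g (x + l)"
        using continuous_on_tendsto_compose[OF cont, of "\<lambda>k. X k + l"] by simp
    qed
    show "AE l in count_space int_span. norm (g (X k + l)) \<le> (\<bar>C\<bar> * (1 + R) powr s) * (1 + norm l) powr (-s)" for k
      using decay_translate[OF _ g R, where x = "_"] s by (intro AE_I2) (subst add.commute, auto)
  qed simp_all
qed

end

section \<open>Characters on the cell\<close>

definition character :: "'a::real_inner \<Rightarrow> 'a \<Rightarrow> complex" where
  "character y x = cis (2 * pi * (y \<bullet> x))"

lemma norm_character [simp]: "norm (character y x) = 1"
  by (simp add: character_def)

lemma character_0 [simp]: "character 0 x = 1" "character y 0 = 1"
  by (simp_all add: character_def)

lemma character_add_left: "character (y + z) x = character y x * character z x"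
  by (simp add: character_def cis_mult inner_add_left distrib_left)

lemma character_add_right: "character y (x + l) = character y x * character y l"
  by (simp add: character_def cis_mult inner_add_right distrib_left)

lemma character_Ints: "y \<bullet> l \<in> \<int> \<Longrightarrow> character y l = 1"
  by (auto simp: character_def elim!: Ints_cases)

lemma continuous_character [continuous_intros]:
  "continuous_on A f \<Longrightarrow> continuous_on A (\<lambda>x. character y (f x))"
  unfolding character_def by (intro continuous_intros)

text \<open>
  The transform of \<open>fourier\<close> for complex-valued functions, which is needed because the argument also
  transforms products of \<open>f\<close> with characters.
\<close>

definition fourier_integral :: "(real ^ 'n \<Rightarrow> complex) \<Rightarrow> real ^ 'n \<Rightarrow> complex" where
  "fourier_integral g y = (\<integral>x. g x * character (- y) x \<partial>lborel)"

context lattice_basis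
begin

lemma character_dual:
  assumes "y \<in> dual_lattice int_span" "l \<in> int_span"
  shows "character y (x + l) = character y x"
  using assms by (simp add: character_add_right character_Ints dual_lattice_def)

abbreviation cell_measure :: "(real ^ 'n) measure" where
  "cell_measure \<equiv> restrict_space lborel cell"

lemma finite_cell_measure: "finite_measure cell_measure"
  by (rule finite_measureI) (use cell_finite in \<open>simp add: space_restrict_space emeasure_restrict_space\<close>)

lemma integral_cell_measure:
  fixes f :: "real ^ 'n \<Rightarrow> 'b::{banach,second_countable_topology}"
  shows "(\<integral>x. f x \<partial>cell_measure) = (\<integral>x. indicator cell x *\<^sub>R f x \<partial>lborel)"
  by (rule integral_restrict_space) simp

lemma measurable_cell_measure:
  fixes f :: "real ^ 'n \<Rightarrow> 'b::{banach,second_countable_topology}"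
  assumes "continuous_on UNIV f"
  shows "f \<in> borel_measurable cell_measure"
  using borel_measurable_continuous_onI[OF assms] by (intro measurable_restrict_space1) simp

lemma integrable_cell_measure:
  fixes f :: "real ^ 'n \<Rightarrow> 'b::{banach,second_countable_topology}"
  assumes f: "continuous_on UNIV f"
  shows "integrable cell_measure f"
proof -
  interpret finite_measure cell_measure by (rule finite_cell_measure)
  have "bounded (f ` closed_cell)"
    by (rule compact_imp_bounded[OF
        compact_continuous_image[OF continuous_on_subset[OF f subset_UNIV] compact_closed_cell]])
  then obtain M where M: "\<And>y. y \<in> f ` closed_cell \<Longrightarrow> norm y \<le> M"
    unfolding bounded_iff by blast
  show ?thesis
  proof (rule integrable_const_bound)
    show "AE x in cell_measure. norm (f x) \<le> M"
    proof (rule AE_I2)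
      fix x assume "x \<in> space cell_measure"
      then have "x \<in> closed_cell" using cell_subset_closed_cell by (auto simp: space_restrict_space)
      then show "norm (f x) \<le> M" using M by blast
    qed
  qed (rule measurable_cell_measure[OF f])
qed

text \<open>
  For a periodic integrand the shifted cell serves as well as the cell, since it too meets every orbit
  of the lattice exactly once. The proof folds the integral over the shifted cell back onto the cell.
\<close>

lemma integral_cell_translate:
  fixes H :: "real ^ 'n \<Rightarrow> complex"
  assumes H: "continuous_on UNIV H" and per: "\<And>x l. l \<in> int_span \<Longrightarrow> H (x + l) = H x"
  shows "(\<integral>x. H (x + w) \<partial>cell_measure) = (\<integral>x. H x \<partial>cell_measure)"
proof -
  have Hw: "continuous_on UNIV (\<lambda>x. H (x + w))"
    by (rule continuous_on_compose2[OF H]) (auto intro!: continuous_intros)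
  have [measurable]: "H \<in> borel_measurable borel" by (rule borel_measurable_continuous_onI[OF H])
  define g where "g x = indicator cell (x - w) *\<^sub>R H x" for x
  have [measurable]: "g \<in> borel_measurable borel" unfolding g_def by measurable
  have gw: "g (x + w) = indicator cell x *\<^sub>R H (x + w)" for x by (simp add: g_def)
  have int: "integrable lborel g"
  proof (rule integrableI_bounded)
    have "(\<lambda>x. ennreal (norm (g x))) \<in> borel_measurable borel" by measurable
    from nn_integral_lborel_translate[OF this, of w]
    have "(\<integral>\<^sup>+x. ennreal (norm (g x)) \<partial>lborel) = (\<integral>\<^sup>+x. ennreal (norm (indicator cell x *\<^sub>R H (x + w))) \<partial>lborel)"
      by (simp add: gw)
    also have "\<dots> < \<infinity>"
    proof -
      have "integrable lborel (\<lambda>x. indicator cell x *\<^sub>R H (x + w))"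
        using integrable_cell_measure[OF Hw] by (subst (asm) integrable_restrict_space) auto
      then show ?thesis unfolding integrable_iff_bounded by blast
    qed
    finally show "(\<integral>\<^sup>+x. ennreal (norm (g x)) \<partial>lborel) < \<infinity>" .
  qed simp
  have per1: "(\<integral>l. g (x + l) \<partial>count_space int_span) = H x" for x
  proof -
    obtain a where a: "a \<in> int_span" "x - w - a \<in> cell"
      "\<And>l. l \<in> int_span \<Longrightarrow> x - w - l \<in> cell \<Longrightarrow> l = a"
      using cell_translate_unique[of "x - w"] by blast
    have "(\<integral>l. g (x + l) \<partial>count_space int_span) = g (x + (- a))"
    proof (rule integral_count_space_single[OF int_span_group(3)[OF a(1)]])
      fix l assume l: "l \<in> int_span" "l \<noteq> - a"
      then have "x - w - (- l) \<notin> cell"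
        using a(3)[OF int_span_group(3)[OF l(1)]] by (metis minus_equation_iff)
      then show "g (x + l) = 0" by (simp add: g_def algebra_simps)
    qed
    also have "\<dots> = H (x + (- a))"
      using a(2) by (simp add: g_def algebra_simps)
    also have "\<dots> = H x" by (rule per[OF int_span_group(3)[OF a(1)]])
    finally show ?thesis .
  qed
  have "(\<integral>x. H (x + w) \<partial>cell_measure) = (\<integral>x. g (x + w) \<partial>lborel)"
    by (simp only: integral_cell_measure gw)
  also have "\<dots> = (\<integral>x. g x \<partial>lborel)" by (rule integral_lborel_translate) simp
  also have "\<dots> = (\<integral>x. H x \<partial>cell_measure)"
    unfolding integral_unfold[OF int] per1 integral_cell_measure ..
  finally show ?thesis .
qed

text \<open>
  For \<open>y \<noteq> 0\<close>, translating by a \<open>w\<close> with \<open>y \<bullet> w = 1/2\<close> preserves the integral but changes the sign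
  of the character.
\<close>

lemma integral_character:
  assumes y: "y \<in> dual_lattice int_span"
  shows "(\<integral>x. character y x \<partial>cell_measure) = (if y = 0 then of_real covol else 0)"
proof (cases "y = 0")
  case True
  then show ?thesis
    by (simp add: covol_def measure_restrict_space space_restrict_space of_real_def)
next
  case False
  obtain b where b: "b \<in> B" "y \<bullet> b \<noteq> 0"
  proof (rule ccontr)
    assume "\<not> thesis"
    then have "\<And>b. b \<in> B \<Longrightarrow> y \<bullet> b = 0" using that by blast
    then have "(\<Sum>b\<in>B. (y \<bullet> b) *\<^sub>R dual_vec b) = 0" by simp
    then show False using False by (simp only: dual_expansion)
  qed
  \<comment> \<open>normalised so that \<open>y \<bullet> w = 1/2\<close>\<close>
  define w where "w = (1 / (2 * (y \<bullet> b))) *\<^sub>R b"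
  have "y \<bullet> w = 1/2" using b(2) by (simp add: w_def)
  then have w: "character y w = -1" by (simp only: character_def) simp
  have "(\<integral>x. character y (x + w) \<partial>cell_measure) = (\<integral>x. character y x \<partial>cell_measure)"
    by (rule integral_cell_translate) (auto intro!: continuous_intros character_dual y)
  then have "- (\<integral>x. character y x \<partial>cell_measure) = (\<integral>x. character y x \<partial>cell_measure)"
    unfolding character_add_right w by simp
  then show ?thesis using False by (simp add: minus_equation_iff equal_neg_zero)
qed

section \<open>Uniqueness of Fourier coefficients\<close>

text \<open>
  On the closed cell this trigonometric polynomial attains its maximum \<open>1\<close> only at the origin, which
  makes powers of it, raised by a small constant, concentrate there.
\<close>

definition cosine_mean :: "real ^ 'n \<Rightarrow> real" where
  "cosine_mean x = (\<Sum>b\<in>B. cos (2 * pi * (dual_vec b \<bullet> x))) / real (card B)"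

lemma card_B_pos: "real (card B) > 0"
  using finite_B B_nonempty by (simp add: card_gt_0_iff)

lemma continuous_cosine_mean: "continuous_on A cosine_mean"
  unfolding cosine_mean_def using card_B_pos by (intro continuous_intros) auto

lemma cosine_mean_0: "cosine_mean 0 = 1"
  using card_B_pos by (simp add: cosine_mean_def)

lemma cosine_mean_ge: "- 1 \<le> cosine_mean x"
proof -
  have "(\<Sum>b\<in>B. - 1) \<le> (\<Sum>b\<in>B. cos (2 * pi * (dual_vec b \<bullet> x)))"
    by (rule sum_mono) (rule cos_ge_minus_one)
  then show ?thesis using card_B_pos by (simp add: cosine_mean_def field_simps)
qed

lemma cosine_mean_less:
  assumes x: "x \<in> closed_cell" "x \<noteq> 0"
  shows "cosine_mean x < 1"
proof -
  obtain b where b: "b \<in> B" "dual_vec b \<bullet> x \<noteq> 0"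
  proof (rule ccontr)
    assume "\<not> thesis"
    then have "\<And>b. b \<in> B \<Longrightarrow> dual_vec b \<bullet> x = 0" using that by blast
    then have "(\<Sum>b\<in>B. (dual_vec b \<bullet> x) *\<^sub>R b) = 0" by simp
    then show False using x(2) by (simp only: basis_expansion)
  qed
  have "cos (2 * pi * (dual_vec b \<bullet> x)) \<noteq> 1"
  proof
    assume "cos (2 * pi * (dual_vec b \<bullet> x)) = 1"
    then obtain k :: int where "2 * pi * (dual_vec b \<bullet> x) = of_int k * 2 * pi"
      using cos_one_2pi_int by auto
    then have k: "dual_vec b \<bullet> x = of_int k" by simp
    moreover have "\<bar>dual_vec b \<bullet> x\<bar> \<le> 1/2" using x(1) b(1) by (simp add: closed_cell_def)
    ultimately have "k = 0" by linarith
    then show False using k b(2) by simp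
  qed
  then have lt: "cos (2 * pi * (dual_vec b \<bullet> x)) < 1"
    using cos_le_one[of "2 * pi * (dual_vec b \<bullet> x)"] by linarith
  have "(\<Sum>b\<in>B. cos (2 * pi * (dual_vec b \<bullet> x))) < (\<Sum>b\<in>B. 1)"
    by (rule sum_strict_mono_ex1[OF finite_B]) (use b(1) lt in auto)
  then show ?thesis using card_B_pos by (simp add: cosine_mean_def field_simps)
qed

text \<open>
  Multiplying by a cosine of frequency \<open>dual_vec b\<close> only shifts frequencies within the dual lattice.
  Hence orthogonality to all characters survives multiplication by the kernel, for any exponent.
\<close>

lemma integral_kernel_zero:
  fixes G :: "real ^ 'n \<Rightarrow> complex"
  assumes G: "continuous_on UNIV G"
    and zero: "\<And>y. y \<in> dual_lattice int_span \<Longrightarrow> (\<integral>x. character y x * G x \<partial>cell_measure) = 0"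
    and y: "y \<in> dual_lattice int_span"
  shows "(\<integral>x. of_real ((cosine_mean x + \<eta>) ^ k) * (character y x * G x) \<partial>cell_measure) = 0"
  using y
proof (induction k arbitrary: y)
  case 0
  then show ?case by (simp add: zero)
next
  case (Suc k)
  let ?Q = "\<lambda>x. (of_real ((cosine_mean x + \<eta>) ^ k) :: complex)"
  let ?f = "\<lambda>z x. ?Q x * (character z x * G x)"
  have cont: "continuous_on UNIV (?f z)" for z
    by (intro continuous_intros continuous_cosine_mean G)
  have int: "integrable cell_measure (?f z)" for z by (rule integrable_cell_measure[OF cont])
  let ?c = "of_real (1 / (2 * real (card B))) :: complex"
  have cos: "of_real (cos (2 * pi * (w \<bullet> x))) = (character w x + character (- w) x) / 2" for w x :: "real ^ 'n"
    by (simp add: character_def cis_conv_exp cos_of_real[symmetric] cos_exp_eq)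
  have eq: "of_real ((cosine_mean x + \<eta>) ^ Suc k) * (character y x * G x) =
      of_real \<eta> * ?f y x + ?c * (\<Sum>b\<in>B. ?f (dual_vec b + y) x + ?f (- dual_vec b + y) x)" for x
  proof -
    have "of_real (cosine_mean x) = ?c * (\<Sum>b\<in>B. character (dual_vec b) x + character (- dual_vec b) x)"
      by (simp add: cosine_mean_def cos sum_divide_distrib[symmetric])
    then have *: "of_real (cosine_mean x) * ?f y x =
        ?c * (\<Sum>b\<in>B. (character (dual_vec b) x + character (- dual_vec b) x) * ?f y x)"
      by (simp only: sum_distrib_right mult.assoc)
    have "(\<Sum>b\<in>B. (character (dual_vec b) x + character (- dual_vec b) x) * ?f y x)
        = (\<Sum>b\<in>B. ?f (dual_vec b + y) x + ?f (- dual_vec b + y) x)"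
      unfolding character_add_left by (intro sum.cong refl) (simp add: algebra_simps)
    moreover have "of_real ((cosine_mean x + \<eta>) ^ Suc k) * (character y x * G x)
        = of_real \<eta> * ?f y x + of_real (cosine_mean x) * ?f y x"
      by (simp add: algebra_simps)
    ultimately show ?thesis using * by (simp only:)
  qed
  have z: "(\<integral>x. ?f y x \<partial>cell_measure) = 0" if "y \<in> dual_lattice int_span" for y
    using Suc.IH[OF that] .
  have zs: "(\<integral>x. (\<Sum>b\<in>B. ?f (dual_vec b + y) x + ?f (- dual_vec b + y) x) \<partial>cell_measure) = 0"
  proof -
    have "(\<integral>x. (\<Sum>b\<in>B. ?f (dual_vec b + y) x + ?f (- dual_vec b + y) x) \<partial>cell_measure)
        = (\<Sum>b\<in>B. (\<integral>x. ?f (dual_vec b + y) x + ?f (- dual_vec b + y) x \<partial>cell_measure))"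
      by (rule Bochner_Integration.integral_sum) (intro Bochner_Integration.integrable_add int)
    also have "\<dots> = (\<Sum>b\<in>B. 0)"
    proof (rule sum.cong[OF refl])
      fix b assume b: "b \<in> B"
      have "dual_vec b + y \<in> dual_lattice int_span" "- dual_vec b + y \<in> dual_lattice int_span"
        using dual_vec_in_dual[OF b] Suc.prems by (blast intro: dual_group)+
      then show "(\<integral>x. ?f (dual_vec b + y) x + ?f (- dual_vec b + y) x \<partial>cell_measure) = 0"
        by (subst Bochner_Integration.integral_add[OF int int]) (simp only: z add_0_left)
    qed
    finally show ?thesis by simp
  qed
  have ints: "integrable cell_measure (\<lambda>x. \<Sum>b\<in>B. ?f (dual_vec b + y) x + ?f (- dual_vec b + y) x)"
    by (intro Bochner_Integration.integrable_sum Bochner_Integration.integrable_add int)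
  have "(\<integral>x. of_real ((cosine_mean x + \<eta>) ^ Suc k) * (character y x * G x) \<partial>cell_measure) =
     of_real \<eta> * (\<integral>x. ?f y x \<partial>cell_measure) +
     ?c * (\<integral>x. (\<Sum>b\<in>B. ?f (dual_vec b + y) x + ?f (- dual_vec b + y) x) \<partial>cell_measure)"
    unfolding eq
    by (subst Bochner_Integration.integral_add)
       (simp_all only: integrable_mult_right int ints integral_mult_right_zero)
  then show ?case unfolding zs z[OF Suc.prems] by simp
qed

text \<open>
  Suppose \<open>G 0 \<noteq> 0\<close> and rotate so that the real part \<open>H\<close> is positive at the origin. The kernel
  \<open>(cosine_mean + \<eta>)\<^sup>2\<^sup>N\<close> is nonnegative, grows exponentially in \<open>N\<close> on a neighbourhood of the
  origin where \<open>H\<close> exceeds a positive constant, and is at most \<open>1\<close> at the points of the cell where \<open>H\<close> is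
  negative. So the integral of \<open>H\<close> against it over the cell tends to infinity, although it is always
  zero.
\<close>

lemma vanishing_coefficients:
  fixes G :: "real ^ 'n \<Rightarrow> complex"
  assumes G: "continuous_on UNIV G"
    and zero: "\<And>y. y \<in> dual_lattice int_span \<Longrightarrow> (\<integral>x. character y x * G x \<partial>cell_measure) = 0"
  shows "G 0 = 0"
proof (rule ccontr)
  assume "G 0 \<noteq> 0"
  define h where "h = (cmod (G 0))\<^sup>2"
  have h: "h > 0" using \<open>G 0 \<noteq> 0\<close> by (simp add: h_def)
  define H where "H x = Re (cnj (G 0) * G x)" for x
  have contH: "continuous_on A H" for A
    unfolding H_def by (intro continuous_intros continuous_on_subset[OF G]) auto
  have H0: "H 0 = h" by (simp add: H_def h_def cmod_power2) (simp add: power2_eq_square)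
  have intH: "(\<integral>x. (cosine_mean x + \<eta>) ^ k * H x \<partial>cell_measure) = 0" for \<eta> k
  proof -
    have "integrable cell_measure (\<lambda>x. of_real ((cosine_mean x + \<eta>) ^ k) * (character 0 x * G x))"
      by (intro integrable_cell_measure continuous_intros continuous_cosine_mean G)
    then have "integrable cell_measure (\<lambda>x. cnj (G 0) * (of_real ((cosine_mean x + \<eta>) ^ k) * (character 0 x * G x)))"
      by (rule integrable_mult_right)
    note int = this
    have re: "Re (cnj (G 0) * (of_real ((cosine_mean x + \<eta>) ^ k) * (character 0 x * G x)))
        = (cosine_mean x + \<eta>) ^ k * H x" for x
      unfolding H_def by (simp add: algebra_simps del: of_real_power)
    from integral_Re[OF int]
    have "(\<integral>x. Re (cnj (G 0) * (of_real ((cosine_mean x + \<eta>) ^ k) * (character 0 x * G x))) \<partial>cell_measure)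
        = Re (cnj (G 0) * (\<integral>x. of_real ((cosine_mean x + \<eta>) ^ k) * (character 0 x * G x) \<partial>cell_measure))"
      by (simp only: integral_mult_right_zero)
    also have "\<dots> = 0"
      using integral_kernel_zero[OF G zero, of 0 \<eta> k] by (simp add: dual_iff)
    finally show ?thesis by (simp only: re)
  qed
  \<comment> \<open>the set where \<open>H \<le> h / 2\<close> is compact and avoids the origin, so \<open>cosine_mean\<close> stays away from \<open>1\<close> there\<close>
  obtain \<eta> where \<eta>: "\<eta> > 0" "\<eta> < 1"
    "\<And>x. x \<in> closed_cell \<Longrightarrow> H x \<le> h / 2 \<Longrightarrow> cosine_mean x + \<eta> \<le> 1"
  proof (cases "\<exists>x\<in>closed_cell. H x \<le> h / 2")
    case False
    then show ?thesis using that[of "1/2"] by auto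
  next
    case True
    let ?F = "closed_cell \<inter> {x. H x \<le> h / 2}"
    have "closed {x. H x \<le> h / 2}" by (intro closed_Collect_le contH continuous_intros)
    then have "compact ?F" by (rule compact_Int_closed[OF compact_closed_cell])
    moreover have "?F \<noteq> {}" using True by blast
    ultimately obtain m where m: "m \<in> ?F" "\<And>x. x \<in> ?F \<Longrightarrow> cosine_mean x \<le> cosine_mean m"
      using continuous_attains_sup[of ?F cosine_mean] continuous_cosine_mean by blast
    have "m \<noteq> 0" using m(1) h H0 by auto
    then have "cosine_mean m < 1" using cosine_mean_less m(1) by blast
    then show ?thesis
      using that[of "min (1/2) (1 - cosine_mean m)"] m(2) by fastforce
  qed
  obtain M where M: "M \<ge> 0" "\<And>x. x \<in> closed_cell \<Longrightarrow> \<bar>H x\<bar> \<le> M"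
  proof -
    have "bounded (H ` closed_cell)"
      by (rule compact_imp_bounded[OF compact_continuous_image[OF contH compact_closed_cell]])
    then obtain M where M: "\<And>x. x \<in> closed_cell \<Longrightarrow> \<bar>H x\<bar> \<le> M"
      unfolding bounded_iff real_norm_def by blast
    show ?thesis
    proof (rule that[of "max 0 M"])
      show "\<bar>H x\<bar> \<le> max 0 M" if "x \<in> closed_cell" for x
        using M[OF that] by (rule max.coboundedI2)
    qed (rule max.cobounded1)
  qed
  \<comment> \<open>any number strictly between \<open>1\<close> and the kernel base \<open>1 + \<eta>\<close> at the origin\<close>
  define q where "q = 1 + \<eta> / 2"
  have q: "q > 1" using \<eta> by (simp add: q_def)
  let ?U = "{x. H x > h / 2} \<inter> {x. cosine_mean x + \<eta> > q}"
  have "open ?U"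
    by (intro open_Int open_Collect_less contH continuous_intros continuous_cosine_mean)
  moreover have "0 \<in> ?U" using h H0 \<eta> by (simp add: cosine_mean_0 q_def)
  ultimately obtain r1 where r1: "r1 > 0" "ball 0 r1 \<subseteq> ?U" by (rule openE)
  obtain r2 where r2: "r2 > 0" "ball 0 r2 \<subseteq> cell" using ball_subset_cell by blast
  define V where "V = ball (0 :: real ^ 'n) (min r1 r2)"
  have V: "V \<subseteq> ?U" "V \<subseteq> cell" using r1 r2 by (auto simp: V_def)
  define v where "v = measure lborel V"
  have v: "v > 0" using r1 r2 by (simp add: v_def V_def content_ball)
  have bound: "h / 2 * (q\<^sup>2) ^ N * v \<le> M * covol" for N
  proof -
    let ?g = "\<lambda>x. (cosine_mean x + \<eta>) ^ (2 * N) * H x"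
    \<comment> \<open>the exponent \<open>2 * N\<close> is even, so the kernel is nonnegative\<close>
    have pt: "h / 2 * (q\<^sup>2) ^ N * indicator V x - M \<le> ?g x" if x: "x \<in> cell" for x
    proof (cases "x \<in> V")
      case True
      then have "H x \<ge> h / 2" "cosine_mean x + \<eta> \<ge> q" using V(1) by force+
      then have "h / 2 * q ^ (2 * N) \<le> H x * (cosine_mean x + \<eta>) ^ (2 * N)"
        using h q by (intro mult_mono power_mono) auto
      moreover have "h / 2 * (q\<^sup>2) ^ N * indicator V x = h / 2 * q ^ (2 * N)"
        using True by (simp add: power_mult)
      moreover have "H x * (cosine_mean x + \<eta>) ^ (2 * N) = ?g x" by (rule mult.commute)
      ultimately show ?thesis using M(1) by linarith
    next
      case False
      have xc: "x \<in> closed_cell" using x cell_subset_closed_cell by blast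
      have "- M \<le> ?g x"
      proof (cases "H x \<ge> 0")
        case True
        then have "0 \<le> ?g x" by (intro mult_nonneg_nonneg) (auto simp: power_mult)
        then show ?thesis using M(1) by linarith
      next
        case neg: False
        then have "cosine_mean x + \<eta> \<le> 1" using \<eta>(3)[OF xc] h by linarith
        moreover have "- 1 \<le> cosine_mean x + \<eta>" using cosine_mean_ge[of x] \<eta>(1) by linarith
        ultimately have "\<bar>cosine_mean x + \<eta>\<bar> ^ (2 * N) \<le> 1" by (intro power_le_one) auto
        then have "\<bar>?g x\<bar> \<le> 1 * M"
          unfolding abs_mult power_abs by (intro mult_mono M(2) xc) auto
        then show ?thesis by linarith
      qed
      then show ?thesis using False by simp
    qed
    have Vm: "V \<in> sets lborel" by (simp add: V_def)
    interpret finite_measure cell_measure by (rule finite_cell_measure)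
    have Vm': "V \<in> sets cell_measure" using Vm V(2) by (auto simp: sets_restrict_space_iff)
    have mV: "measure cell_measure V = v" using V(2) by (simp add: v_def measure_restrict_space)
    have mC: "measure cell_measure cell = covol"
      by (simp add: covol_def measure_restrict_space)
    have iV: "integrable cell_measure (\<lambda>x. h / 2 * (q\<^sup>2) ^ N * indicator V x)"
      using Vm' by (intro integrable_mult_right integrable_real_indicator) (auto simp: emeasure_eq_measure)
    have "h / 2 * (q\<^sup>2) ^ N * v - M * covol = (\<integral>x. h / 2 * (q\<^sup>2) ^ N * indicator V x - M \<partial>cell_measure)"
      using iV Vm' sets.sets_into_space[OF Vm'] by (subst Bochner_Integration.integral_diff) (auto simp: mV mC Int_absorb2 space_restrict_space)
    also have "\<dots> \<le> (\<integral>x. ?g x \<partial>cell_measure)"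
    proof (rule integral_mono)
      show "integrable cell_measure (\<lambda>x. h / 2 * (q\<^sup>2) ^ N * indicator V x - M)"
        using iV by (intro Bochner_Integration.integrable_diff) auto
      show "integrable cell_measure ?g"
        by (intro integrable_cell_measure continuous_intros contH continuous_cosine_mean)
    qed (use pt in \<open>simp add: space_restrict_space\<close>)
    also have "\<dots> = 0" by (rule intH)
    finally show ?thesis by simp
  qed
  have "q\<^sup>2 > 1" using q by (simp add: one_less_power)
  then obtain N where "M * covol / (h / 2 * v) < (q\<^sup>2) ^ N" using real_arch_pow by blast
  then have "M * covol < (q\<^sup>2) ^ N * (h / 2 * v)" using h v by (simp add: pos_divide_less_eq)
  then show False using bound[of N] by (simp add: mult_ac)
qed

section \<open>Poisson summation\<close>

text \<open>
  The periodization of \<open>g\<close>, times the covolume, and the character series with coefficients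
  \<open>fourier_integral g y\<close> have the same integrals against all characters over the cell. By
  \<open>vanishing_coefficients\<close> they agree at \<open>0\<close>, which is the formula.
\<close>

theorem poisson_summation:
  fixes g :: "real ^ 'n \<Rightarrow> complex" and s :: real
  assumes cont: "continuous_on UNIV g"
    and s: "s > real CARD('n)" and g: "\<And>x. norm (g x) \<le> C * (1 + norm x) powr (-s)"
    and sum: "integrable (count_space (dual_lattice int_span)) (\<lambda>y. fourier_integral g y)"
  shows "of_real covol * (\<integral>l. g l \<partial>count_space int_span) =
    (\<integral>y. fourier_integral g y \<partial>count_space (dual_lattice int_span))"
proof -
  let ?D = "dual_lattice int_span"
  interpret D: lattice_basis "dual_vec ` B" by (rule dual_basis)
  have cD: "countable ?D" using D.countable_int_span by (simp only: dual_eq_int_span)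
  interpret cellM: finite_measure cell_measure by (rule finite_cell_measure)
  have [measurable]: "g \<in> borel_measurable borel" by (rule borel_measurable_continuous_onI[OF cont])
  have intg: "integrable lborel g"
  proof (rule Bochner_Integration.integrable_bound)
    show "integrable lborel (\<lambda>x::real ^ 'n. C * (1 + norm x) powr (-s))"
      using s by (intro integrable_mult_right integrable_powr_decay) simp
    show "AE x in lborel. norm (g x) \<le> norm (C * (1 + norm x) powr (-s))"
      by (rule AE_I2, rule order_trans[OF g]) simp
  qed simp
  define P where "P x = (\<integral>l. g (x + l) \<partial>count_space int_span)" for x
  have contP: "continuous_on UNIV P"
    unfolding P_def by (rule continuous_periodization[OF s g cont])
  define S where "S x = (\<integral>y. fourier_integral g y * character y x \<partial>count_space ?D)" for x
  have contS: "continuous_on UNIV S"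
    unfolding continuous_on_sequentially comp_def S_def
  proof (intro allI ballI impI, elim conjE)
    fix X :: "nat \<Rightarrow> real ^ 'n" and x assume X: "X \<longlonglongrightarrow> x"
    show "(\<lambda>k. \<integral>y. fourier_integral g y * character y (X k) \<partial>count_space ?D)
        \<longlonglongrightarrow> (\<integral>y. fourier_integral g y * character y x \<partial>count_space ?D)"
    proof (rule integral_dominated_convergence)
      show "integrable (count_space ?D) (\<lambda>y. norm (fourier_integral g y))"
        using sum by (rule integrable_norm)
      show "AE y in count_space ?D. (\<lambda>k. fourier_integral g y * character y (X k)) \<longlonglongrightarrow> fourier_integral g y * character y x"
      proof (rule AE_I2)
        fix y :: "real ^ 'n"
        have "continuous_on UNIV (character y)" by (intro continuous_intros)
        then have "(\<lambda>k. character y (X k)) \<longlonglongrightarrow> character y x"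
          by (rule continuous_on_tendsto_compose[OF _ X]) auto
        then show "(\<lambda>k. fourier_integral g y * character y (X k)) \<longlonglongrightarrow> fourier_integral g y * character y x"
          by (rule tendsto_mult_left)
      qed
    qed (simp_all add: norm_mult)
  qed
  have coefP: "(\<integral>x. character z x * P x \<partial>cell_measure) = fourier_integral g (- z)" if z: "z \<in> ?D" for z
  proof -
    have "integrable lborel (\<lambda>x. g x * character z x)"
    proof (rule Bochner_Integration.integrable_bound[OF intg])
      have "character z \<in> borel_measurable borel"
        by (intro borel_measurable_continuous_onI continuous_intros)
      then show "(\<lambda>x. g x * character z x) \<in> borel_measurable lborel" by simp
    qed (simp add: norm_mult)
    note int = this
    have per: "(\<integral>l. g (x + l) * character z (x + l) \<partial>count_space int_span) = character z x * P x" for x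
    proof -
      have "(\<integral>l. g (x + l) * character z (x + l) \<partial>count_space int_span)
          = (\<integral>l. character z x * g (x + l) \<partial>count_space int_span)"
        by (rule Bochner_Integration.integral_cong[OF refl]) (simp add: character_dual[OF z])
      then show ?thesis unfolding P_def by (simp only: integral_mult_right_zero)
    qed
    show ?thesis
      using integral_unfold[OF int]
      by (simp only: fourier_integral_def integral_cell_measure minus_minus per)
  qed
  have coefS: "(\<integral>x. character z x * S x \<partial>cell_measure) = of_real covol * fourier_integral g (- z)" if z: "z \<in> ?D" for z
  proof -
    have "(\<integral>x. character z x * S x \<partial>cell_measure) =
        (\<integral>x. (\<integral>y. fourier_integral g y * character (z + y) x \<partial>count_space ?D) \<partial>cell_measure)"
    proof (rule Bochner_Integration.integral_cong[OF refl])
      fix x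
      have "character z x * S x = (\<integral>y. character z x * (fourier_integral g y * character y x) \<partial>count_space ?D)"
        unfolding S_def by (simp only: integral_mult_right_zero)
      then show "character z x * S x = (\<integral>y. fourier_integral g y * character (z + y) x \<partial>count_space ?D)"
        by (simp only: character_add_left mult_ac)
    qed
    also have "\<dots> = (\<integral>y. (\<integral>x. fourier_integral g y * character (z + y) x \<partial>cell_measure) \<partial>count_space ?D)"
    proof (rule integral_count_space_swap[OF cellM.sigma_finite_measure_axioms cD])
      show "(\<lambda>x. fourier_integral g y * character (z + y) x) \<in> borel_measurable cell_measure" for y
        by (intro measurable_cell_measure continuous_intros)
      have "(\<integral>\<^sup>+y. \<integral>\<^sup>+x. ennreal (norm (fourier_integral g y * character (z + y) x)) \<partial>cell_measure \<partial>count_space ?D)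
         = (\<integral>\<^sup>+y. emeasure cell_measure (space cell_measure) * ennreal (norm (fourier_integral g y)) \<partial>count_space ?D)"
        by (simp add: norm_mult mult.commute)
      also have "\<dots> = emeasure cell_measure (space cell_measure) * (\<integral>\<^sup>+y. ennreal (norm (fourier_integral g y)) \<partial>count_space ?D)"
        by (rule nn_integral_cmult) simp
      also have "\<dots> < \<infinity>"
      proof -
        have "emeasure cell_measure (space cell_measure) < top"
          using cellM.emeasure_finite by (simp only: less_top[symmetric] not_False_eq_True)
        moreover have "(\<integral>\<^sup>+y. ennreal (norm (fourier_integral g y)) \<partial>count_space ?D) < top"
          using sum unfolding integrable_iff_bounded by simp
        ultimately show ?thesis unfolding infinity_ennreal_def ennreal_mult_less_top by blast
      qed
      finally show "(\<integral>\<^sup>+y. \<integral>\<^sup>+x. ennreal (norm (fourier_integral g y * character (z + y) x)) \<partial>cell_measure \<partial>count_space ?D) < \<infinity>" .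
    qed
    also have "\<dots> = (\<integral>y. fourier_integral g y * (if z + y = 0 then of_real covol else 0) \<partial>count_space ?D)"
      by (rule Bochner_Integration.integral_cong[OF refl])
         (simp add: integral_character dual_group z)
    also have "\<dots> = fourier_integral g (- z) * (if z + (- z) = 0 then of_real covol else 0)"
      by (rule integral_count_space_single) (auto simp: dual_group z add_eq_0_iff)
    finally show ?thesis by simp
  qed
  have "of_real covol * P 0 - S 0 = 0"
  proof (rule vanishing_coefficients[where G = "\<lambda>x. of_real covol * P x - S x"])
    show "continuous_on UNIV (\<lambda>x. of_real covol * P x - S x)"
      by (intro continuous_intros contP contS)
    fix z assume z: "z \<in> ?D"
    have i: "integrable cell_measure (\<lambda>x. character z x * P x)" "integrable cell_measure (\<lambda>x. character z x * S x)"
      by (intro integrable_cell_measure continuous_intros contP contS)+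
    have "(\<integral>x. character z x * (of_real covol * P x - S x) \<partial>cell_measure)
        = (\<integral>x. of_real covol * (character z x * P x) - character z x * S x \<partial>cell_measure)"
      by (simp add: algebra_simps)
    also have "\<dots> = of_real covol * (\<integral>x. character z x * P x \<partial>cell_measure) - (\<integral>x. character z x * S x \<partial>cell_measure)"
      using i by (simp add: Bochner_Integration.integral_diff)
    also have "\<dots> = 0" by (simp add: coefP coefS z)
    finally show "(\<integral>x. character z x * (of_real covol * P x - S x) \<partial>cell_measure) = 0" .
  qed
  then show ?thesis by (simp add: P_def S_def)
qed

end

section \<open>Fourier transforms of affine images\<close>

lemma integral_lborel_scale:
  fixes F :: "'a::euclidean_space \<Rightarrow> 'b::{banach,second_countable_topology}"
  assumes [measurable]: "F \<in> borel_measurable borel" and u: "u > 0"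
  shows "(\<integral>x. F x \<partial>lborel) = u ^ DIM('a) *\<^sub>R (\<integral>x. F (u *\<^sub>R x) \<partial>lborel)"
proof -
  have "(\<integral>x. F x \<partial>lborel) = (\<integral>x. F x \<partial>density (distr lborel borel (\<lambda>x. 0 + u *\<^sub>R x)) (\<lambda>_. ennreal (\<bar>u\<bar> ^ DIM('a))))"
    using u by (subst lborel_affine[of u 0]) (auto simp: ennreal_power)
  also have "\<dots> = (\<integral>x. \<bar>u\<bar> ^ DIM('a) *\<^sub>R F x \<partial>distr lborel borel (\<lambda>x. 0 + u *\<^sub>R x))"
    by (rule integral_density) auto
  also have "\<dots> = (\<integral>x. \<bar>u\<bar> ^ DIM('a) *\<^sub>R F (0 + u *\<^sub>R x) \<partial>lborel)"
    by (rule integral_distr) auto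
  finally show ?thesis using u by simp
qed

lemma fourier_integral_modulate:
  "fourier_integral (\<lambda>x. g x * character v x) y = fourier_integral g (y - v)"
  unfolding fourier_integral_def
proof (rule Bochner_Integration.integral_cong[OF refl])
  fix x
  have "character (- (y - v)) x = character v x * character (- y) x"
    by (simp flip: character_add_left)
  then show "g x * character v x * character (- y) x = g x * character (- (y - v)) x" by simp
qed

lemma fourier_integral_affine:
  fixes g :: "real ^ 'n \<Rightarrow> complex"
  assumes g: "continuous_on UNIV g" and u: "u > 0"
  shows "fourier_integral (\<lambda>x. g (u *\<^sub>R (x - v))) y =
    of_real (1 / u ^ CARD('n)) * character (- y) v * fourier_integral g ((1 / u) *\<^sub>R y)"
proof -
  have [measurable]: "g \<in> borel_measurable borel" by (rule borel_measurable_continuous_onI[OF g])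
  have [measurable]: "character z \<in> borel_measurable borel" for z :: "real ^ 'n"
    by (intro borel_measurable_continuous_onI continuous_intros)
  have "(\<lambda>x. g (u *\<^sub>R (x - v)) * character (- y) x) \<in> borel_measurable borel" by measurable
  from integral_lborel_translate[OF this, of v]
  have "fourier_integral (\<lambda>x. g (u *\<^sub>R (x - v))) y
      = (\<integral>x. character (- y) v * (g (u *\<^sub>R x) * character (- y) x) \<partial>lborel)"
    by (simp add: fourier_integral_def character_add_right mult_ac)
  also have "\<dots> = character (- y) v * (\<integral>x. g (u *\<^sub>R x) * character (- y) x \<partial>lborel)"
    by (rule integral_mult_right_zero)
  also have "(\<integral>x. g (u *\<^sub>R x) * character (- y) x \<partial>lborel) = of_real (1 / u ^ CARD('n)) * fourier_integral g ((1 / u) *\<^sub>R y)"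
  proof -
    have "(\<lambda>x. g x * character (- ((1 / u) *\<^sub>R y)) x) \<in> borel_measurable borel" by measurable
    from integral_lborel_scale[OF this u]
    have "fourier_integral g ((1 / u) *\<^sub>R y) = u ^ CARD('n) *\<^sub>R (\<integral>x. g (u *\<^sub>R x) * character (- y) x \<partial>lborel)"
      using u by (simp add: fourier_integral_def character_def)
    then show ?thesis using u by (simp add: scaleR_conv_of_real)
  qed
  finally show ?thesis by (simp add: mult_ac)
qed

lemma fourier_eq: "fourier h y = fourier_integral (\<lambda>x. complex_of_real (h x)) y"
  unfolding fourier_def fourier_integral_def character_def cis_conv_exp
  by (rule Bochner_Integration.integral_cong[OF refl]) (simp add: inner_commute mult_ac)

section \<open>Lattice sums of admissible functions\<close>

lemma is_latticeE:
  assumes "is_lattice L"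
  obtains B where "lattice_basis B" "L = lattice_basis.int_span B"
proof -
  obtain B where B: "independent B" "span B = UNIV"
    and L: "L = {\<Sum>b\<in>B. of_int (c b) *\<^sub>R b | c :: real ^ 'a \<Rightarrow> int. True}"
    using assms unfolding is_lattice_def by blast
  have b: "lattice_basis B" by (rule lattice_basis.intro[OF B])
  show thesis by (rule that[OF b]) (simp only: L lattice_basis.int_span_def[OF b])
qed

lemma is_lattice_dual:
  assumes "is_lattice L"
  shows "is_lattice (dual_lattice L)"
proof -
  obtain B where B: "lattice_basis B" "L = lattice_basis.int_span B" using assms by (rule is_latticeE)
  show ?thesis
    unfolding B(2) lattice_basis.dual_eq_int_span[OF B(1)]
    by (rule lattice_basis.is_lattice_int_span[OF lattice_basis.dual_basis[OF B(1)]])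
qed

lemma lattice_integrable_of_decay:
  fixes g :: "real ^ 'n \<Rightarrow> 'b::{banach,second_countable_topology}"
  assumes "is_lattice L" "s > real CARD('n)" "\<And>x. norm (g x) \<le> C * (1 + norm x) powr (-s)"
  shows "integrable (count_space L) g"
proof -
  obtain B where B: "lattice_basis B" "L = lattice_basis.int_span B" using assms(1) by (rule is_latticeE)
  show ?thesis unfolding B(2) using lattice_basis.summable_of_decay[OF B(1) assms(2,3)] .
qed

lemma decay_affine:
  fixes g :: "'a::real_normed_vector \<Rightarrow> 'b::real_normed_vector"
  assumes s: "s \<ge> 0" and g: "\<And>x. norm (g x) \<le> C * (1 + norm x) powr (-s)" and u: "0 < u" "u \<le> 1"
  shows "\<exists>C'. \<forall>x. norm (g (u *\<^sub>R (x - v))) \<le> C' * (1 + norm x) powr (-s)"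
proof -
  define M where "M = \<bar>C\<bar> * (1 + norm (- (u *\<^sub>R v))) powr s"
  have M: "M \<ge> 0" by (simp add: M_def)
  have "norm (g (u *\<^sub>R (x - v))) \<le> (M * (1 / u) powr s) * (1 + norm x) powr (-s)" for x
  proof -
    have "norm (g (u *\<^sub>R x + (- (u *\<^sub>R v)))) \<le> M * (1 + norm (u *\<^sub>R x)) powr (-s)"
      unfolding M_def by (rule decay_translate[OF s g order_refl])
    also have "\<dots> \<le> M * ((1 / u) powr s * (1 + norm x) powr (-s))"
    proof (rule mult_left_mono[OF _ M])
      have "1 + norm x \<le> (1 / u) * (1 + norm (u *\<^sub>R x))"
        using u by (simp add: field_simps)
      then show "(1 + norm (u *\<^sub>R x)) powr (-s) \<le> (1 / u) powr s * (1 + norm x) powr (-s)"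
        using s by (intro powr_decay_shift) (auto intro: add_pos_nonneg)
    qed
    finally show ?thesis by (simp add: scaleR_diff_right mult.assoc)
  qed
  then show ?thesis by blast
qed

lemma admissible_continuous: "admissible h \<Longrightarrow> continuous_on UNIV h"
  by (simp add: admissible_def)

lemma admissible_decay:
  fixes h :: "real ^ 'n \<Rightarrow> real"
  assumes "admissible h"
  obtains s C where "s > real CARD('n)" "\<And>x. norm (h x) \<le> C * (1 + norm x) powr (-s)"
proof -
  obtain d C where d: "d > 0" "\<And>x. \<bar>h x\<bar> \<le> C * (1 + norm x) powr (- real CARD('n) - d)"
    using assms unfolding admissible_def by blast
  have e: "- real CARD('n) - d = - (real CARD('n) + d)" by simp
  show thesis
  proof (rule that)
    show "real CARD('n) + d > real CARD('n)" using d(1) by simp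
    show "norm (h x) \<le> C * (1 + norm x) powr (- (real CARD('n) + d))" for x
      using d(2)[of x] unfolding e real_norm_def .
  qed
qed

lemma admissible_summable:
  assumes h: "admissible h" and "is_lattice L" "t > 0"
  shows "integrable (count_space (dual_lattice L)) (\<lambda>y. fourier h (t *\<^sub>R y))"
proof -
  have "(\<lambda>l. cmod (fourier h (t *\<^sub>R l))) summable_on dual_lattice L"
    using assms unfolding admissible_def by blast
  then show ?thesis
    using abs_summable_equivalent[of "\<lambda>l. fourier h (t *\<^sub>R l)" "dual_lattice L"]
    by (simp add: Infinite_Set_Sum.abs_summable_on_def)
qed

lemma admissible_fourier:
  assumes h: "admissible h"
  shows "0 \<le> Re (fourier h y)" "t \<ge> 1 \<Longrightarrow> Re (fourier h (t *\<^sub>R y)) \<le> Re (fourier h y)"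
    "cmod (fourier h y) = Re (fourier h y)"
proof -
  have "\<And>t. t \<ge> 1 \<Longrightarrow> 0 \<le> Re (fourier h (t *\<^sub>R y)) \<and> Re (fourier h (t *\<^sub>R y)) \<le> Re (fourier h y)"
    and r: "fourier h y \<in> \<real>"
    using h unfolding admissible_def by blast+
  from this(1) show nn: "0 \<le> Re (fourier h y)" and "t \<ge> 1 \<Longrightarrow> Re (fourier h (t *\<^sub>R y)) \<le> Re (fourier h y)"
    using order_trans by blast+
  show "cmod (fourier h y) = Re (fourier h y)"
    using r nn by (auto elim!: Reals_cases)
qed

text \<open>
  Poisson summation turns the left-hand side into \<open>1/covol\<close> times a sum of values of the transform of \<open>h\<close>
  at the points \<open>y / u\<close>, multiplied by phases coming from \<open>v\<close>. Nonnegativity of the transform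
  allows the phases to be dropped, and monotonicity on rays allows \<open>y / u\<close> to be replaced by \<open>y\<close>, after
  which Poisson summation is applied backwards.
\<close>

lemma lattice_sum_affine_le:
  fixes h :: "real ^ 'n \<Rightarrow> real"
  assumes h: "admissible h" and L: "is_lattice L" and u: "0 < u" "u \<le> 1"
  shows "integrable (count_space L) (\<lambda>l. h (u *\<^sub>R (l - v)))"
    and "u ^ CARD('n) * (\<integral>l. h (u *\<^sub>R (l - v)) \<partial>count_space L) \<le> (\<integral>l. h l \<partial>count_space L)"
proof -
  obtain B where B: "lattice_basis B" and LB: "L = lattice_basis.int_span B" using L by (rule is_latticeE)
  interpret lattice_basis B by (rule B)
  obtain s C where s: "s > real CARD('n)" and dec: "\<And>x. norm (h x) \<le> C * (1 + norm x) powr (-s)"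
    using admissible_decay[OF h] by blast
  have s0: "s \<ge> 0" using s by simp
  obtain C' where dec': "\<And>x. norm (h (u *\<^sub>R (x - v))) \<le> C' * (1 + norm x) powr (-s)"
    using decay_affine[OF s0 dec u, of v] by blast
  show int: "integrable (count_space L) (\<lambda>l. h (u *\<^sub>R (l - v)))"
    by (rule lattice_integrable_of_decay[OF L s dec'])
  have cont: "continuous_on UNIV (\<lambda>x. complex_of_real (h x))"
    by (intro continuous_intros admissible_continuous[OF h])
  have cont': "continuous_on UNIV (\<lambda>x. complex_of_real (h (u *\<^sub>R (x - v))))"
    by (intro continuous_intros continuous_on_compose2[OF admissible_continuous[OF h]]) auto
  let ?D = "dual_lattice L"
  let ?n = "u ^ CARD('n)"
  have ft: "fourier_integral (\<lambda>x. complex_of_real (h (u *\<^sub>R (x - v)))) y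
      = of_real (1 / ?n) * character (- y) v * fourier h ((1 / u) *\<^sub>R y)" for y
    using fourier_integral_affine[OF cont u(1), of v y] by (simp only: fourier_eq)
  have sum0: "integrable (count_space ?D) (\<lambda>y. fourier h y)"
    using admissible_summable[OF h L, of 1] by simp
  have sum1: "integrable (count_space ?D) (\<lambda>y. fourier h ((1 / u) *\<^sub>R y))"
    using admissible_summable[OF h L, of "1 / u"] u by simp
  have sum2: "integrable (count_space ?D) (\<lambda>y. of_real (1 / ?n) * character (- y) v * fourier h ((1 / u) *\<^sub>R y))"
  proof (rule Bochner_Integration.integrable_bound)
    show "integrable (count_space ?D) (\<lambda>y. of_real (1 / ?n) * fourier h ((1 / u) *\<^sub>R y))"
      by (intro integrable_mult_right sum1)
  qed (simp_all add: norm_mult norm_divide norm_power)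
  have p0: "of_real covol * (\<integral>l. complex_of_real (h l) \<partial>count_space L) = (\<integral>y. fourier h y \<partial>count_space ?D)"
    using poisson_summation[OF cont s, of C] dec sum0 by (simp add: LB fourier_eq)
  have p1: "of_real covol * (\<integral>l. complex_of_real (h (u *\<^sub>R (l - v))) \<partial>count_space L)
      = (\<integral>y. of_real (1 / ?n) * character (- y) v * fourier h ((1 / u) *\<^sub>R y) \<partial>count_space ?D)"
    using poisson_summation[OF cont' s, of C'] dec' sum2 unfolding ft LB by simp
  have "covol * (\<integral>l. h (u *\<^sub>R (l - v)) \<partial>count_space L)
      = (\<integral>y. Re (of_real (1 / ?n) * character (- y) v * fourier h ((1 / u) *\<^sub>R y)) \<partial>count_space ?D)"
    using arg_cong[OF p1, of Re] by (simp only: integral_Re[OF sum2] integral_complex_of_real of_real_mult[symmetric] Re_complex_of_real)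
  also have "\<dots> \<le> (\<integral>y. (1 / ?n) * Re (fourier h y) \<partial>count_space ?D)"
  proof (rule integral_mono)
    show "integrable (count_space ?D) (\<lambda>y. Re (of_real (1 / ?n) * character (- y) v * fourier h ((1 / u) *\<^sub>R y)))"
      by (rule integrable_Re[OF sum2])
    show "integrable (count_space ?D) (\<lambda>y. (1 / ?n) * Re (fourier h y))"
      by (intro integrable_mult_right integrable_Re sum0)
    fix y
    have "Re (of_real (1 / ?n) * character (- y) v * fourier h ((1 / u) *\<^sub>R y))
        \<le> cmod (of_real (1 / ?n) * character (- y) v * fourier h ((1 / u) *\<^sub>R y))"
      by (rule complex_Re_le_cmod)
    also have "\<dots> = (1 / ?n) * Re (fourier h ((1 / u) *\<^sub>R y))"
      using u by (simp only: norm_mult norm_character norm_of_real admissible_fourier(3)[OF h]) simp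
    also have "\<dots> \<le> (1 / ?n) * Re (fourier h y)"
      using u by (intro mult_left_mono admissible_fourier(2)[OF h]) auto
    finally show "Re (of_real (1 / ?n) * character (- y) v * fourier h ((1 / u) *\<^sub>R y)) \<le> (1 / ?n) * Re (fourier h y)" .
  qed
  also have "\<dots> = (1 / ?n) * (\<integral>y. Re (fourier h y) \<partial>count_space ?D)"
    by (rule integral_mult_right_zero)
  also have "(\<integral>y. Re (fourier h y) \<partial>count_space ?D) = covol * (\<integral>l. h l \<partial>count_space L)"
    using arg_cong[OF p0, of Re] by (simp only: integral_Re[OF sum0] integral_complex_of_real of_real_mult[symmetric] Re_complex_of_real)
  finally have "covol * (?n * (\<integral>l. h (u *\<^sub>R (l - v)) \<partial>count_space L)) \<le> covol * (\<integral>l. h l \<partial>count_space L)"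
    using u by (simp add: field_simps)
  then show "?n * (\<integral>l. h (u *\<^sub>R (l - v)) \<partial>count_space L) \<le> (\<integral>l. h l \<partial>count_space L)"
    using covol_pos by simp
qed

text \<open>
  A bounded \<open>K\<close> has points outside it, so every supremum in \<open>nu\<close> ranges over a nonempty set of
  positive numbers; for \<open>K = UNIV\<close> the value would be \<open>-\<infinity>\<close>.
\<close>

lemma nu_nonneg:
  assumes h: "\<And>x. h x > 0" and K: "bounded K"
  shows "0 \<le> nu h K"
proof -
  have "K \<noteq> UNIV" using K not_bounded_UNIV by metis
  then obtain x where x: "x \<notin> K" by blast
  show ?thesis
    unfolding nu_def
  proof (rule INF_greatest)
    fix u :: real assume u: "u \<in> {0<..1}"
    have "0 \<le> ereal (h x / (u ^ CARD('a) * h (u *\<^sub>R x)))"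
      using u h[of x] h[of "u *\<^sub>R x"] by (simp add: less_imp_le)
    also have "\<dots> \<le> (SUP x\<in>-K. ereal (h x / (u ^ CARD('a) * h (u *\<^sub>R x))))"
      using x by (intro SUP_upper) simp
    finally show "0 \<le> (SUP x\<in>-K. ereal (h x / (u ^ CARD('a) * h (u *\<^sub>R x))))" .
  qed
qed

text \<open>
  A scale \<open>u\<close> that nearly realises the infimum in \<open>nu h K\<close> bounds each term outside \<open>K\<close> by
  \<open>c u\<^sup>n h(u(l - v))\<close>; the sum of these over the whole lattice is controlled by
  \<open>lattice_sum_affine_le\<close>.
\<close>

lemma lattice_tail_le:
  fixes h :: "real ^ 'n \<Rightarrow> real"
  assumes h: "admissible h" "\<And>x. h x > 0" and L: "is_lattice L"
    and c: "nu h K < ereal c" "c \<ge> 0"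
  shows "(\<integral>l. (if l - v \<in> K then 0 else h (l - v)) \<partial>count_space L) \<le> c * (\<integral>l. h l \<partial>count_space L)"
proof -
  obtain u where u: "0 < u" "u \<le> 1" and sup: "(SUP x\<in>-K. ereal (h x / (u ^ CARD('n) * h (u *\<^sub>R x)))) < ereal c"
    using c(1) unfolding nu_def INF_less_iff by auto
  have pt: "h x \<le> c * (u ^ CARD('n) * h (u *\<^sub>R x))" if "x \<notin> K" for x
  proof -
    have "ereal (h x / (u ^ CARD('n) * h (u *\<^sub>R x))) \<le> (SUP x\<in>-K. ereal (h x / (u ^ CARD('n) * h (u *\<^sub>R x))))"
      using that by (intro SUP_upper) simp
    then have "ereal (h x / (u ^ CARD('n) * h (u *\<^sub>R x))) < ereal c" using sup by (rule le_less_trans)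
    then have "h x / (u ^ CARD('n) * h (u *\<^sub>R x)) \<le> c" by simp
    moreover have "0 < u ^ CARD('n) * h (u *\<^sub>R x)" using u h(2) by simp
    ultimately show ?thesis by (simp add: pos_divide_le_eq)
  qed
  note aff = lattice_sum_affine_le[OF h(1) L u, of v]
  have int1: "integrable (count_space L) (\<lambda>l. h (l - v))"
    using lattice_sum_affine_le(1)[OF h(1) L, of 1 v] by simp
  have "(\<integral>l. (if l - v \<in> K then 0 else h (l - v)) \<partial>count_space L)
      \<le> (\<integral>l. c * (u ^ CARD('n) * h (u *\<^sub>R (l - v))) \<partial>count_space L)"
  proof (rule integral_mono)
    show "integrable (count_space L) (\<lambda>l. if l - v \<in> K then 0 else h (l - v))"
      by (rule Bochner_Integration.integrable_bound[OF int1]) auto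
    show "integrable (count_space L) (\<lambda>l. c * (u ^ CARD('n) * h (u *\<^sub>R (l - v))))"
      by (intro integrable_mult_right aff(1))
    show "(if l - v \<in> K then 0 else h (l - v)) \<le> c * (u ^ CARD('n) * h (u *\<^sub>R (l - v)))" for l
      using pt[of "l - v"] c(2) u(1) h(2)[of "u *\<^sub>R (l - v)"] by (auto simp: less_imp_le)
  qed
  also have "\<dots> = c * (u ^ CARD('n) * (\<integral>l. h (u *\<^sub>R (l - v)) \<partial>count_space L))"
    by (simp only: integral_mult_right_zero)
  also have "\<dots> \<le> c * (\<integral>l. h l \<partial>count_space L)"
    by (rule mult_left_mono[OF aff(2) c(2)])
  finally show ?thesis .
qed

section \<open>Transference\<close>

text \<open>
  The heart of the matter: a lattice without nonzero points in \<open>K\<close>, whose dual has a translate missing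
  \<open>K'\<close>, forces the two tail constants to be large. The value \<open>f 0\<close> is compared with the
  sum \<open>S\<close> of \<open>f\<close> over the lattice: \<open>near\<close> bounds it from below by \<open>(1 - a) S\<close>, while \<open>lower\<close> and \<open>far\<close>
  together bound it from above by \<open>(1 + b) S / 2\<close>.
\<close>

lemma transference_alternative:
  fixes f fhat :: "real ^ 'n \<Rightarrow> real"
  assumes fhat: "\<And>x. fourier f x = complex_of_real (fhat x)"
    and f_pos: "\<And>x. f x > 0" and fhat_pos: "\<And>x. fhat x > 0"
    and f_adm: "admissible f" and fhat_adm: "admissible fhat" and L: "is_lattice L"
    and a: "nu f K < ereal a" "a \<ge> 0" and b: "nu fhat K' < ereal b" "b \<ge> 0"
    and short: "\<And>l. l \<in> L \<Longrightarrow> l \<noteq> 0 \<Longrightarrow> l \<notin> K"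
    and deep: "\<And>m. m \<in> dual_lattice L \<Longrightarrow> m - v \<notin> K'"
  shows "1 \<le> 2 * a + b"
proof -
  obtain B where B: "lattice_basis B" and LB: "L = lattice_basis.int_span B" using L by (rule is_latticeE)
  interpret lattice_basis B by (rule B)
  let ?D = "dual_lattice L"
  define S where "S = (\<integral>l. f l \<partial>count_space L)"
  define T where "T = (\<integral>m. fhat m \<partial>count_space ?D)"
  have D: "is_lattice ?D" by (rule is_lattice_dual[OF L])
  have zero: "0 \<in> L" unfolding LB by (rule int_span_group)
  obtain s C where s: "s > real CARD('n)" and dec: "\<And>x. norm (f x) \<le> C * (1 + norm x) powr (-s)"
    using admissible_decay[OF f_adm] by blast
  have intf: "integrable (count_space L) f" by (rule lattice_integrable_of_decay[OF L s dec])
  have int_hat: "integrable (count_space ?D) (\<lambda>m. fhat (m - w))" for w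
    using lattice_sum_affine_le(1)[OF fhat_adm D, of 1 w] by simp
  have cont: "continuous_on UNIV (\<lambda>x. complex_of_real (f x))"
    by (intro continuous_intros admissible_continuous[OF f_adm])
  have poisson: "of_real covol * (\<integral>l. complex_of_real (f l) * character w l \<partial>count_space L)
      = (\<integral>m. complex_of_real (fhat (m - w)) \<partial>count_space ?D)" for w
  proof -
    have ft: "fourier_integral (\<lambda>x. complex_of_real (f x) * character w x) m = complex_of_real (fhat (m - w))" for m
      unfolding fourier_integral_modulate by (simp only: fhat[symmetric] fourier_eq)
    have "of_real covol * (\<integral>l. complex_of_real (f l) * character w l \<partial>count_space int_span)
      = (\<integral>m. fourier_integral (\<lambda>x. complex_of_real (f x) * character w x) m \<partial>count_space (dual_lattice int_span))"
    proof (rule poisson_summation[OF _ s, where C = C])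
      show "continuous_on UNIV (\<lambda>x. complex_of_real (f x) * character w x)"
        by (intro continuous_intros cont)
      show "cmod (complex_of_real (f x) * character w x) \<le> C * (1 + norm x) powr (-s)" for x
        using dec[of x] by (simp add: norm_mult)
      show "integrable (count_space (dual_lattice int_span)) (\<lambda>y. fourier_integral (\<lambda>x. complex_of_real (f x) * character w x) y)"
        unfolding ft using int_hat[of w] unfolding LB by (rule integrable_of_real)
    qed
    then show ?thesis unfolding ft LB .
  qed
  have TS: "T = covol * S"
    using poisson[of 0] unfolding S_def T_def
    by (simp only: character_0 mult_1_right diff_zero integral_complex_of_real of_real_mult[symmetric] of_real_eq_iff)
  have single: "(\<integral>l. (if l = 0 then c else 0) \<partial>count_space L) = c" for c :: real
    using integral_count_space_single[OF zero, of "\<lambda>l. if l = 0 then c else 0"] by simp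
  have int_single: "integrable (count_space L) (\<lambda>l. if l = 0 then c else (0::real))" for c
  proof (rule Bochner_Integration.integrable_bound[OF integrable_mult_right[OF intf, of "c / f 0"]])
    show "AE l in count_space L. norm (if l = 0 then c else 0) \<le> norm (c / f 0 * f l)"
      using f_pos[of 0] by (intro AE_I2) (auto simp: abs_mult)
  qed simp
  have near: "S - f 0 \<le> a * S"
  proof -
    have "S - f 0 = (\<integral>l. f l - (if l = 0 then f 0 else 0) \<partial>count_space L)"
      unfolding S_def by (subst Bochner_Integration.integral_diff[OF intf int_single]) (simp only: single)
    also have "\<dots> \<le> (\<integral>l. (if l - 0 \<in> K then 0 else f (l - 0)) \<partial>count_space L)"
    proof (rule integral_mono)
      show "integrable (count_space L) (\<lambda>l. if l - 0 \<in> K then 0 else f (l - 0))"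
        by (rule Bochner_Integration.integrable_bound[OF intf]) auto
      show "f l - (if l = 0 then f 0 else 0) \<le> (if l - 0 \<in> K then 0 else f (l - 0))"
        if "l \<in> space (count_space L)" for l
        using short[of l] that f_pos[of l] by (auto simp: less_imp_le)
    qed (intro Bochner_Integration.integrable_diff intf int_single)
    also have "\<dots> \<le> a * S"
      unfolding S_def by (rule lattice_tail_le[OF f_adm f_pos L a])
    finally show ?thesis .
  qed
  have far: "(\<integral>m. fhat (m - v) \<partial>count_space ?D) \<le> b * T"
  proof -
    have "(\<integral>m. fhat (m - v) \<partial>count_space ?D) = (\<integral>m. (if m - v \<in> K' then 0 else fhat (m - v)) \<partial>count_space ?D)"
      by (rule Bochner_Integration.integral_cong[OF refl]) (use deep in auto)
    also have "\<dots> \<le> b * T"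
      unfolding T_def by (rule lattice_tail_le[OF fhat_adm fhat_pos D b])
    finally show ?thesis .
  qed
  have lower: "covol * (2 * f 0 - S) \<le> (\<integral>m. fhat (m - v) \<partial>count_space ?D)"
  proof -
    have int: "integrable (count_space L) (\<lambda>l. complex_of_real (f l) * character v l)"
      by (rule Bochner_Integration.integrable_bound[OF intf]) (simp_all add: norm_mult)
    have "2 * f 0 - S = (\<integral>l. (if l = 0 then 2 * f 0 else 0) - f l \<partial>count_space L)"
      unfolding S_def by (subst Bochner_Integration.integral_diff[OF int_single intf]) (simp only: single)
    also have "\<dots> \<le> (\<integral>l. Re (complex_of_real (f l) * character v l) \<partial>count_space L)"
    proof (rule integral_mono)
      show "(if l = 0 then 2 * f 0 else 0) - f l \<le> Re (complex_of_real (f l) * character v l)" for l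
      proof (cases "l = 0")
        case False
        have "\<bar>Re (complex_of_real (f l) * character v l)\<bar> \<le> f l"
          using abs_Re_le_cmod[of "complex_of_real (f l) * character v l"] f_pos[of l] by (simp add: norm_mult)
        then show ?thesis using False by simp
      qed simp
    qed (intro Bochner_Integration.integrable_diff intf int_single integrable_Re[OF int])+
    also have "\<dots> = Re (\<integral>l. complex_of_real (f l) * character v l \<partial>count_space L)"
      by (rule integral_Re[OF int])
    finally have "covol * (2 * f 0 - S) \<le> covol * Re (\<integral>l. complex_of_real (f l) * character v l \<partial>count_space L)"
      by (rule mult_left_mono) (rule less_imp_le[OF covol_pos])
    also have "\<dots> = Re (of_real covol * (\<integral>l. complex_of_real (f l) * character v l \<partial>count_space L))"
      by simp
    also have "\<dots> = (\<integral>m. fhat (m - v) \<partial>count_space ?D)"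
      by (simp only: poisson integral_complex_of_real Re_complex_of_real)
    finally show ?thesis .
  qed
  have "covol * (2 * f 0 - S) \<le> covol * (b * S)"
    using lower far by (simp add: TS mult.left_commute)
  then have "2 * f 0 - S \<le> b * S" using covol_pos by simp
  then have "1 * S \<le> (2 * a + b) * S" using near by (simp add: algebra_simps)
  moreover have "S > 0"
  proof -
    have "f 0 = (\<integral>l. (if l = 0 then f 0 else 0) \<partial>count_space L)" by (simp only: single)
    also have "\<dots> \<le> S"
      unfolding S_def
      by (rule integral_mono[OF int_single intf]) (use f_pos in \<open>auto simp: less_imp_le\<close>)
    finally show ?thesis using f_pos[of 0] by linarith
  qed
  ultimately show ?thesis by (simp only: mult_le_cancel_right_pos)
qed

lemma is_lattice_scale:
  assumes "is_lattice L" "t \<noteq> 0"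
  shows "is_lattice ((*\<^sub>R) t ` L)"
proof -
  obtain B where B: "independent B" "span B = UNIV"
    and L: "L = {\<Sum>b\<in>B. of_int (c b) *\<^sub>R b | c :: real ^ 'a \<Rightarrow> int. True}"
    using assms(1) unfolding is_lattice_def by blast
  have lin: "linear ((*\<^sub>R) t :: real ^ 'a \<Rightarrow> _)" by (rule linear_scaleR)
  have inj: "inj ((*\<^sub>R) t :: real ^ 'a \<Rightarrow> _)" using assms(2) by (auto intro: injI)
  have inj_B: "inj_on ((*\<^sub>R) t) B" using inj by (rule inj_on_subset) simp
  have surj: "surj ((*\<^sub>R) t :: real ^ 'a \<Rightarrow> _)"
    using assms(2) by (intro surjI[of _ "(*\<^sub>R) (1 / t)"]) simp
  have "independent ((*\<^sub>R) t ` B)"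
    by (rule linear_independent_injective_image[OF lin B(1)]) (use inj in \<open>simp add: B(2)\<close>)
  moreover have "span ((*\<^sub>R) t ` B) = UNIV"
    using surj by (simp add: linear_span_image[OF lin] B(2))
  moreover have "(*\<^sub>R) t ` L = {\<Sum>b\<in>(*\<^sub>R) t ` B. of_int (c b) *\<^sub>R b | c :: real ^ 'a \<Rightarrow> int. True}"
  proof (rule Set.set_eqI, rule iffI)
    fix x assume "x \<in> (*\<^sub>R) t ` L"
    then obtain c :: "real ^ 'a \<Rightarrow> int" where x: "x = t *\<^sub>R (\<Sum>b\<in>B. of_int (c b) *\<^sub>R b)"
      unfolding L by blast
    have "x = (\<Sum>b\<in>(*\<^sub>R) t ` B. of_int (c ((1 / t) *\<^sub>R b)) *\<^sub>R b)"
      using assms(2) by (simp add: x sum.reindex[OF inj_B] scaleR_sum_right mult.commute)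
    then show "x \<in> {\<Sum>b\<in>(*\<^sub>R) t ` B. of_int (c b) *\<^sub>R b | c :: real ^ 'a \<Rightarrow> int. True}"
      by (auto intro: exI[of _ "\<lambda>b. c ((1 / t) *\<^sub>R b)"])
  next
    fix x assume "x \<in> {\<Sum>b\<in>(*\<^sub>R) t ` B. of_int (c b) *\<^sub>R b | c :: real ^ 'a \<Rightarrow> int. True}"
    then obtain c :: "real ^ 'a \<Rightarrow> int" where "x = (\<Sum>b\<in>(*\<^sub>R) t ` B. of_int (c b) *\<^sub>R b)" by blast
    then have "x = t *\<^sub>R (\<Sum>b\<in>B. of_int (c (t *\<^sub>R b)) *\<^sub>R b)"
      by (simp add: sum.reindex[OF inj_B] scaleR_sum_right mult.commute)
    moreover have "(\<Sum>b\<in>B. of_int (c (t *\<^sub>R b)) *\<^sub>R b) \<in> L"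
      unfolding L by (auto intro: exI[of _ "\<lambda>b. c (t *\<^sub>R b)"])
    ultimately show "x \<in> (*\<^sub>R) t ` L" by (rule image_eqI)
  qed
  ultimately show ?thesis unfolding is_lattice_def by blast
qed

lemma dual_lattice_scale:
  assumes "t \<noteq> 0" "m \<in> dual_lattice ((*\<^sub>R) t ` L)"
  shows "t *\<^sub>R m \<in> dual_lattice L"
  using assms(2) by (simp add: dual_lattice_def)

theorem theorem2p16:
  fixes f fhat :: "real ^ 'n \<Rightarrow> real" and K K' L :: "(real ^ 'n) set"
  assumes "\<And>x. fourier f x = complex_of_real (fhat x)"
    and "\<And>x. f x > 0" and "\<And>x. fhat x > 0"
    and "admissible f" and "admissible fhat"
    and "star_body K" and "star_body K'"
    and "2 * nu f K + nu fhat K' < 1"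
    and "is_lattice L"
  shows "ereal (lattice_min K L) * cover_radius K' (dual_lattice L) \<le> 1"
proof (rule ccontr)
  assume contra: "\<not> ?thesis"
  define \<sigma> where "\<sigma> = lattice_min K L"
  have K: "compact K" "0 \<in> interior K" and K': "compact K'" "0 \<in> interior K'"
    using assms(6,7) by (auto simp: star_body_def)
  have pos: "0 \<le> star_norm K x" "0 \<le> star_norm K' x" for x
    using star_norm_min(1)[OF K] star_norm_min(1)[OF K'] by auto
  obtain B where B: "lattice_basis B" and LB: "L = lattice_basis.int_span B"
    using assms(9) by (rule is_latticeE)
  interpret lattice_basis B by (rule B)
  obtain b where b: "b \<in> B" using B_nonempty by blast
  have ne: "L - {0} \<noteq> {}"
  proof -
    have "b \<in> L" unfolding LB int_span_iff using b by (auto simp: dual_vec_basis)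
    moreover have "b \<noteq> 0" using b indep dependent_zero by blast
    ultimately show ?thesis by blast
  qed
  have \<sigma>_le: "\<sigma> \<le> star_norm K l" if "l \<in> L" "l \<noteq> 0" for l
    unfolding \<sigma>_def lattice_min_def
    by (rule cINF_lower) (use that pos in \<open>auto intro: bdd_belowI2[of _ 0]\<close>)
  have "0 \<le> \<sigma>"
    unfolding \<sigma>_def lattice_min_def by (rule cINF_greatest[OF ne]) (rule pos)
  moreover have "\<sigma> \<noteq> 0"
  proof
    assume "\<sigma> = 0"
    then have "ereal (lattice_min K L) = 0" by (simp only: \<sigma>_def zero_ereal_def)
    then show False using contra by (simp flip: zero_ereal_def)
  qed
  ultimately have \<sigma>: "\<sigma> > 0" by simp
  have "\<not> cover_radius K' (dual_lattice L) \<le> ereal (1 / \<sigma>)"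
  proof
    assume "cover_radius K' (dual_lattice L) \<le> ereal (1 / \<sigma>)"
    then have "ereal \<sigma> * cover_radius K' (dual_lattice L) \<le> ereal \<sigma> * ereal (1 / \<sigma>)"
      using \<sigma> by (intro ereal_mult_left_mono) auto
    then show False using contra \<sigma> by (simp add: \<sigma>_def[symmetric] one_ereal_def)
  qed
  then have "ereal (1 / \<sigma>) < (SUP v. ereal (INF m\<in>dual_lattice L. star_norm K' (m - v)))"
    unfolding cover_radius_def not_le .
  then obtain v where "1 / \<sigma> < (INF m\<in>dual_lattice L. star_norm K' (m - v))"
    unfolding less_SUP_iff by auto
  \<comment> \<open>with this \<open>t\<close>, the nonzero points of \<open>t L\<close> lie outside \<open>K\<close>, and the dual lattice, scaled by \<open>1 / t\<close>, has a translate missing \<open>K'\<close>\<close>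
  then obtain t where t: "1 / \<sigma> < t" "t < (INF m\<in>dual_lattice L. star_norm K' (m - v))"
    using dense by blast
  have t0: "t > 0" using t(1) \<sigma> less_trans[of 0 "1 / \<sigma>" t] by simp
  have far: "t < star_norm K' (m - v)" if "m \<in> dual_lattice L" for m
  proof -
    have "(INF m\<in>dual_lattice L. star_norm K' (m - v)) \<le> star_norm K' (m - v)"
      by (rule cINF_lower) (use that pos in \<open>auto intro: bdd_belowI2[of _ 0]\<close>)
    then show ?thesis using t(2) by simp
  qed
  have nn: "0 \<le> nu f K" "0 \<le> nu fhat K'"
    using K(1) K'(1) by (auto intro!: nu_nonneg assms(2,3) compact_imp_bounded)
  obtain p q where p: "nu f K = ereal p" "p \<ge> 0" and q: "nu fhat K' = ereal q" "q \<ge> 0" and pq: "2 * p + q < 1"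
    using assms(8) nn by (cases "nu f K"; cases "nu fhat K'") auto
  \<comment> \<open>the conclusion \<open>1 \<le> 2 (p + e) + (q + e)\<close> spends the margin \<open>e\<close> three times\<close>
  define e where "e = (1 - (2 * p + q)) / 4"
  have e: "e > 0" using pq by (simp add: e_def)
  have "1 \<le> 2 * (p + e) + (q + e)"
  proof (rule transference_alternative[where K = K and K' = K' and L = "(*\<^sub>R) t ` L" and v = "(1 / t) *\<^sub>R v" and f = f and fhat = fhat])
    show "is_lattice ((*\<^sub>R) t ` L)" using is_lattice_scale[OF assms(9)] t0 by simp
    show "nu f K < ereal (p + e)" "nu fhat K' < ereal (q + e)" using e p q by simp_all
    show "0 \<le> p + e" "0 \<le> q + e" using e p q by simp_all
    show "l \<notin> K" if l: "l \<in> (*\<^sub>R) t ` L" "l \<noteq> 0" for l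
    proof
      assume "l \<in> K"
      obtain x where x: "x \<in> L" "l = t *\<^sub>R x" using l by blast
      have "x = (1 / t) *\<^sub>R l" using x t0 by simp
      then have "x \<in> (*\<^sub>R) (1 / t) ` K" using \<open>l \<in> K\<close> by blast
      then have "star_norm K x \<le> 1 / t" using t0 by (intro star_norm_min(2)[OF K]) auto
      moreover have "\<sigma> \<le> star_norm K x" using x l(2) by (intro \<sigma>_le) auto
      ultimately have "\<sigma> \<le> 1 / t" by linarith
      then show False using t(1) t0 \<sigma> by (simp add: field_simps)
    qed
    show "m - (1 / t) *\<^sub>R v \<notin> K'" if m: "m \<in> dual_lattice ((*\<^sub>R) t ` L)" for m
    proof
      assume mem: "m - (1 / t) *\<^sub>R v \<in> K'"
      have "t *\<^sub>R m - v = t *\<^sub>R (m - (1 / t) *\<^sub>R v)" using t0 by (simp add: scaleR_diff_right)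
      then have "t *\<^sub>R m - v \<in> (*\<^sub>R) t ` K'" using mem by blast
      then have "star_norm K' (t *\<^sub>R m - v) \<le> t" using t0 by (intro star_norm_min(2)[OF K']) auto
      then show False using far[OF dual_lattice_scale[OF _ m]] t0 by simp
    qed
  qed (rule assms)+
  then show False using pq by (simp add: e_def field_simps)
qed

end
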